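(* Consider the system of 5 elastoplastic springs on 4 nodes described in the context, with displacement-controlled loading $l(t)=l_0+l_1t$, $l_0,l_1>0$, and assume that its elastic limits $c_i^-,c_i^+$ satisfy the feasibility condition of one of the 8 scenarios listed in the context. A: If the feasibility condition of one of the scenarios 1–6 holds, then the 2 springs with the indexes from the corresponding $I_0$ undergo plastic deformation for all sufficiently large $t>0$. During this plastic deformation the stresses of the springs are constant and can take any constant value from the line segment $[Ay_{*,1},Ay_{*,2}]$ of that scenario. That is: for every solution there is $t_0$ such that for $t\ge t_0$ the stress vector $s(t)$ is constant and belongs to $[Ay_{*,1},Ay_{*,2}]$ (so $s_j(t)=c_j^+$ for $(+,j)\in I_0$), and every point of this segment is attained in this way by some solution. B: If the feasibility condition of one of the scenarios 7–8 holds, then the 3 springs with the indexes from the corresponding $I_0$ undergo plastic deformation for all sufficiently large $t>0$, and during this plastic deformation the stresses of the remaining 2 springs take the specific constant values given by $Ay_{*,0}$ of that scenario (i.e. for every solution, $s(t)=Ay_{*,0}$ for all sufficiently large $t$).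
   Context: The system: $m=5$, $n=4$, stiffness matrix $A={\rm diag}(a_1,\dots,a_5)$ with $a_i>0$, elastic limits $c_i^-\le c_i^+$, $$D=\begin{pmatrix}-1&1&0&0\\-1&0&1&0\\0&-1&1&0\\0&-1&0&1\\0&0&-1&1\end{pmatrix},\ R=\begin{pmatrix}1\\0\\1\\0\\1\end{pmatrix},\ A\mathcal{V}_{basis}=\begin{pmatrix}0&1&1\\0&1&-1\\1&0&1\\-1&1&0\\1&1&0\end{pmatrix},\ P=\begin{pmatrix}1&0&1&0&1\\0&0&1&-1&1\\1&-1&1&0&0\end{pmatrix}.$$ $\mathcal{V}=\mathcal{V}_{basis}\mathbb{R}^3$ with scalar product $\langle x,Ay\rangle$; $c(t)=-\mathcal{V}_{basis}(P\mathcal{V}_{basis})^{-1}(1,0,0)^Tl(t)$; $C=\{y\in\mathcal{V}:c_i^-\le\langle e_i,Ay\rangle\le c_i^+,\ i=1,\dots,5\}$. The evolution is given by the sweeping process $-\dot y(t)\in N^A_{C+c(t)}(y(t))$ for a.e. $t\ge0$, $y(t)\in C+c(t)$, with $y(0)\in C+c(0)$ arbitrary and $y$ locally absolutely continuous, where for a closed convex set $K\subset\mathcal{V}$, $N^A_K(y)=\{x\in\mathcal{V}:\langle x,A(\xi-y)\rangle\le0\ \forall\xi\in K\}$ for $y\in K$. The stress vector is $s(t)=A(y(t)-c(t))$. Spring $j$ undergoes plastic deformation when $c_j^-<s_j<c_j^+$ is violated, i.e. $s_j\in\{c_j^-,c_j^+\}$. Scenarios ($I_0$; terminal stresses; feasibility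 condition). In scenarios 1–6 $Ay_{*,1}$ and $Ay_{*,2}$ are obtained from the displayed vector with the sign $\mp$ taken as $-$ and $+$ respectively, and the feasibility condition is required for both signs. 1: $I_0=\{(+,1),(+,2)\}$; $(c_1^+,c_2^+,c_3^\mp,c_1^+-c_3^\mp,c_2^++c_3^\mp)$; $c_4^-\le c_1^+-c_3^\mp\le c_4^+$, $c_5^-\le c_2^++c_3^\mp\le c_5^+$. 2: $I_0=\{(+,1),(+,2)\}$; $(c_1^+,c_2^+,c_1^+-c_4^\mp,c_4^\mp,c_1^++c_2^+-c_4^\mp)$; $c_3^-\le c_1^+-c_4^\mp\le c_3^+$, $c_5^-\le c_1^++c_2^+-c_4^\mp\le c_5^+$. 3: $I_0=\{(+,1),(+,2)\}$; $(c_1^+,c_2^+,-c_2^++c_5^\mp,c_1^++c_2^+-c_5^\mp,c_5^\mp)$; $c_3^-\le-c_2^++c_5^\mp\le c_3^+$, $c_4^-\le c_1^++c_2^+-c_5^\mp\le c_4^+$. 4: $I_0=\{(+,4),(+,5)\}$; $(c_1^\mp,-c_1^\mp+c_4^++c_5^+,c_1^\mp-c_4^+,c_4^+,c_5^+)$; $c_2^-\le-c_1^\mp+c_4^++c_5^+\le c_2^+$, $c_3^-\le c_1^\mp-c_4^+\le c_3^+$. 5: $I_0=\{(+,4),(+,5)\}$; $(-c_2^\mp+c_4^++c_5^+,c_2^\mp,-c_2^\mp+c_5^+,c_4^+,c_5^+)$; $c_1^-\le-c_2^\mp+c_4^++c_5^+\le c_1^+$, $c_3^-\le-c_2^\mp+c_5^+\le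 c_3^+$. 6: $I_0=\{(+,4),(+,5)\}$; $(c_3^\mp+c_4^+,-c_3^\mp+c_5^+,c_3^\mp,c_4^+,c_5^+)$; $c_1^-\le c_3^\mp+c_4^+\le c_1^+$, $c_2^-\le-c_3^\mp+c_5^+\le c_2^+$. 7: $I_0=\{(+,1),(-,3),(+,5)\}$; $Ay_{*,0}=(c_1^+,-c_3^-+c_5^+,c_3^-,-c_3^-+c_1^+,c_5^+)$; $c_2^-\le-c_3^-+c_5^+\le c_2^+$, $c_4^-\le-c_3^-+c_1^+\le c_4^+$. 8: $I_0=\{(+,2),(+,3),(+,4)\}$; $Ay_{*,0}=(c_3^++c_4^+,c_2^+,c_3^+,c_4^+,c_2^++c_3^+)$; $c_1^-\le c_3^++c_4^+\le c_1^+$, $c_5^-\le c_2^++c_3^+\le c_5^+$. *)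

theory Defs
  imports "HOL-Analysis.Analysis"
begin

lemma exhaust_5:
  fixes x :: 5
  shows "x = 1 \<or> x = 2 \<or> x = 3 \<or> x = 4 \<or> x = 5"
proof (induct x)
  case (of_int z)
  then have "z = 0 \<or> z = 1 \<or> z = 2 \<or> z = 3 \<or> z = 4" by fastforce
  then show ?case by auto
qed

lemma UNIV_5: "UNIV = {1, 2, 3, 4, 5 :: 5}"
  using exhaust_5 by auto

lemma forall_5: "(\<forall>i::5. P i) \<longleftrightarrow> P 1 \<and> P 2 \<and> P 3 \<and> P 4 \<and> P 5"
  by (metis exhaust_5)

lemma sum_5: "sum f (UNIV::5 set) = f 1 + f 2 + f 3 + f 4 + f 5"
  unfolding UNIV_5 by (simp add: ac_simps)

lemma vector_4 [simp]:
  "(vector [x1, x2, x3, x4] :: 'a::zero^4) $ 1 = x1"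
  "(vector [x1, x2, x3, x4] :: 'a^4) $ 2 = x2"
  "(vector [x1, x2, x3, x4] :: 'a^4) $ 3 = x3"
  "(vector [x1, x2, x3, x4] :: 'a^4) $ 4 = x4"
  unfolding vector_def by auto

lemma vector_5 [simp]:
  "(vector [x1, x2, x3, x4, x5] :: 'a::zero^5) $ 1 = x1"
  "(vector [x1, x2, x3, x4, x5] :: 'a^5) $ 2 = x2"
  "(vector [x1, x2, x3, x4, x5] :: 'a^5) $ 3 = x3"
  "(vector [x1, x2, x3, x4, x5] :: 'a^5) $ 4 = x4"
  "(vector [x1, x2, x3, x4, x5] :: 'a^5) $ 5 = x5"
  unfolding vector_def by auto

text \<open>
  Five elastoplastic springs on four nodes. Springs are indexed by the type \<open>5\<close>, whose elements
  are \<open>1, 2, 3, 4, 5\<close> (with \<open>5 = 0\<close>). Spring \<open>i\<close> has stiffness \<open>a $ i\<close> and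
  elastic limits \<open>cm $ i \<le> cp $ i\<close>.
\<close>

definition D_mat :: "real^4^5" where
  "D_mat = vector [vector [-1,  1,  0, 0],
                   vector [-1,  0,  1, 0],
                   vector [ 0, -1,  1, 0],
                   vector [ 0, -1,  0, 1],
                   vector [ 0,  0, -1, 1]]"

definition R_vec :: "real^5" where
  "R_vec = vector [1, 0, 1, 0, 1]"

definition AV_basis :: "real^3^5" where
  "AV_basis = vector [vector [ 0, 1,  1],
                      vector [ 0, 1, -1],
                      vector [ 1, 0,  1],
                      vector [-1, 1,  0],
                      vector [ 1, 1,  0]]"

definition P_mat :: "real^5^3" where
  "P_mat = vector [vector [1,  0, 1,  0, 1],
                   vector [0,  0, 1, -1, 1],
                   vector [1, -1, 1,  0, 0]]"

definition stiffness :: "real^5 \<Rightarrow> real^5^5" where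
  "stiffness a = (\<chi> i j. if i = j then a $ i else 0)"

definition V_basis :: "real^5 \<Rightarrow> real^3^5" where
  "V_basis a = matrix_inv (stiffness a) ** AV_basis"

definition V_space :: "real^5 \<Rightarrow> (real^5) set" where
  "V_space a = range (\<lambda>x. V_basis a *v x)"

lemma matrix_inv_stiffness:
  assumes "\<forall>i. a $ i > 0"
  shows "stiffness a ** matrix_inv (stiffness a) = mat 1"
    "matrix_inv (stiffness a) ** stiffness a = mat 1"
proof -
  let ?B = "stiffness (\<chi> i. 1 / a $ i)"
  have "stiffness a ** ?B = mat 1" "?B ** stiffness a = mat 1"
    using assms[rule_format, THEN less_imp_neq, symmetric]
    by (auto simp: stiffness_def matrix_matrix_mult_def mat_def vec_eq_iff forall_5 sum_5)
  then have "\<exists>B. stiffness a ** B = mat 1 \<and> B ** stiffness a = mat 1" by blast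
  from someI_ex[OF this] show "stiffness a ** matrix_inv (stiffness a) = mat 1"
    "matrix_inv (stiffness a) ** stiffness a = mat 1"
    unfolding matrix_inv_def by simp_all
qed

text \<open>
  \<open>D_mat\<close> and \<open>R_vec\<close> enter only through this: \<open>V_space a\<close> consists of the \<open>y\<close> for which
  \<open>stiffness a *v y\<close> is orthogonal to all spring elongations \<open>D_mat *v \<xi>\<close> compatible with
  zero loading, \<open>R_vec \<bullet> (D_mat *v \<xi>) = 0\<close>.
\<close>

lemma V_space_iff:
  assumes "\<forall>i. a $ i > 0"
  shows "y \<in> V_space a \<longleftrightarrow>
    (\<forall>\<xi>. R_vec \<bullet> (D_mat *v \<xi>) = 0 \<longrightarrow> (stiffness a *v y) \<bullet> (D_mat *v \<xi>) = 0)"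
proof -
  let ?A = "stiffness a" and ?s = "stiffness a *v y"
  have V: "y \<in> V_space a \<longleftrightarrow> (\<exists>x. ?s = AV_basis *v x)"
  proof -
    have "y = V_basis a *v x \<longleftrightarrow> ?s = AV_basis *v x" for x
    proof
      assume "y = V_basis a *v x"
      then show "?s = AV_basis *v x"
        by (simp add: V_basis_def matrix_vector_mul_assoc matrix_mul_assoc matrix_inv_stiffness[OF assms])
    next
      assume "?s = AV_basis *v x"
      then have "matrix_inv ?A *v ?s = V_basis a *v x"
        by (simp add: V_basis_def matrix_vector_mul_assoc)
      then show "y = V_basis a *v x"
        by (simp add: matrix_vector_mul_assoc matrix_inv_stiffness[OF assms])
    qed
    then show ?thesis by (auto simp: V_space_def)
  qed
  let ?eqs = "\<lambda>s::real^5. s$1 = s$3 + s$4 \<and> s$5 = s$2 + s$3"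
  have 1: "(\<exists>x. s = AV_basis *v x) \<longleftrightarrow> ?eqs s" for s :: "real^5"
  proof
    assume "?eqs s"
    then have "s = AV_basis *v vector [s$3 - (s$1 - s$2) / 2, (s$1 + s$2) / 2, (s$1 - s$2) / 2]"
      by (simp add: AV_basis_def vec_eq_iff forall_5 matrix_vector_mult_def sum_3 field_simps)
    then show "\<exists>x. s = AV_basis *v x" by blast
  qed (auto simp: AV_basis_def matrix_vector_mult_def sum_3)
  have 2: "(\<forall>\<xi>. R_vec \<bullet> (D_mat *v \<xi>) = 0 \<longrightarrow> s \<bullet> (D_mat *v \<xi>) = 0) \<longleftrightarrow> ?eqs s" (is "?L = _")
    for s :: "real^5"
  proof
    assume L: ?L
    from L[rule_format, of "vector [0,1,0,0]"] L[rule_format, of "vector [0,0,1,0]"]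
    show "?eqs s"
      by (simp add: D_mat_def R_vec_def inner_vec_def matrix_vector_mult_def sum_4 sum_5)
  next
    assume "?eqs s"
    then show ?L
      by (auto simp: D_mat_def R_vec_def inner_vec_def matrix_vector_mult_def sum_4 sum_5 algebra_simps)
  qed
  show ?thesis using V 1 2 by simp
qed

text \<open>The \<open>matrix_inv\<close> in the definition of \<open>c_shift\<close> below is a genuine inverse:\<close>

lemma invertible_P_mat_V_basis:
  assumes "\<forall>i. a $ i > 0"
  shows "invertible (P_mat ** V_basis a)"
proof -
  have "x = 0" if x: "(P_mat ** V_basis a) *v x = 0" for x
  proof -
    define v where "v = V_basis a *v x"
    have s: "stiffness a *v v = AV_basis *v x"
      unfolding v_def V_basis_def using matrix_inv_stiffness[OF assms]
      by (simp add: matrix_vector_mul_assoc matrix_mul_assoc)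
    have "P_mat *v v = 0" using x by (simp add: v_def matrix_vector_mul_assoc)
    then have "v$1 + v$3 + v$5 = 0" "v$3 - v$4 + v$5 = 0" "v$1 - v$2 + v$3 = 0"
      by (auto simp: P_mat_def vec_eq_iff forall_3 matrix_vector_mult_def sum_5)
    then have o: "v$3 = v$4 - v$5" "v$1 = - v$4" "v$2 = - v$5" by auto
    have av: "a$1 * v$1 = x$2 + x$3" "a$2 * v$2 = x$2 - x$3" "a$3 * v$3 = x$1 + x$3"
       "a$4 * v$4 = x$2 - x$1" "a$5 * v$5 = x$1 + x$2"
      using s by (auto simp: stiffness_def AV_basis_def vec_eq_iff forall_5 matrix_vector_mult_def sum_5 sum_3)
    have "a$1 * (v$1)^2 + a$2 * (v$2)^2 + a$3 * (v$3)^2 + a$4 * (v$4)^2 + a$5 * (v$5)^2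
      = (a$1 * v$1) * v$1 + (a$2 * v$2) * v$2 + (a$3 * v$3) * v$3 + (a$4 * v$4) * v$4 + (a$5 * v$5) * v$5"
      by (simp add: power2_eq_square)
    also have "\<dots> = 0" unfolding av unfolding o by (simp add: algebra_simps)
    finally have z: "a$1 * (v$1)^2 + a$2 * (v$2)^2 + a$3 * (v$3)^2 + a$4 * (v$4)^2 + a$5 * (v$5)^2 = 0" .
    have "a$i * (v$i)^2 \<ge> 0" for i using assms by (simp add: less_imp_le)
    note nn = this[of 1] this[of 2] this[of 3] this[of 4] this[of 5]
    have "a$1 * (v$1)^2 = 0" "a$2 * (v$2)^2 = 0" "a$3 * (v$3)^2 = 0"
      using z nn by linarith+
    moreover have "a$i \<noteq> 0" for i using assms[rule_format, of i] by simp
    ultimately have "v$1 = 0" "v$2 = 0" "v$3 = 0" by simp_all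
    then show "x = 0" using av(1-3) by (auto simp: vec_eq_iff forall_3)
  qed
  then show ?thesis
    by (simp add: invertible_left_inverse matrix_left_invertible_ker)
qed

definition c_shift :: "real^5 \<Rightarrow> (real \<Rightarrow> real) \<Rightarrow> real \<Rightarrow> real^5" where
  "c_shift a l t =
     - (l t *\<^sub>R (V_basis a *v (matrix_inv (P_mat ** V_basis a) *v vector [1, 0, 0])))"

definition C_set :: "real^5 \<Rightarrow> real^5 \<Rightarrow> real^5 \<Rightarrow> (real^5) set" where
  "C_set a cm cp = {y \<in> V_space a.
     \<forall>i. cm $ i \<le> axis i 1 \<bullet> (stiffness a *v y) \<and> axis i 1 \<bullet> (stiffness a *v y) \<le> cp $ i}"

definition moving_set :: "real^5 \<Rightarrow> real^5 \<Rightarrow> real^5 \<Rightarrow> (real \<Rightarrow> real) \<Rightarrow> real \<Rightarrow> (real^5) set" where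
  "moving_set a cm cp l t = (\<lambda>x. x + c_shift a l t) ` C_set a cm cp"

text \<open>
  The normal cone within \<open>V_space a\<close> for the scalar product \<open>x \<bullet> (stiffness a *v y)\<close>;
  it is empty at points outside \<open>K\<close>.
\<close>

definition normal_cone :: "real^5 \<Rightarrow> (real^5) set \<Rightarrow> real^5 \<Rightarrow> (real^5) set" where
  "normal_cone a K y =
     {x \<in> V_space a. y \<in> K \<and> (\<forall>\<xi>\<in>K. x \<bullet> (stiffness a *v (\<xi> - y)) \<le> 0)}"

text \<open>
  Absolute continuity of functions of a real variable (the library's \<open>absolutely_continuous\<close> is
  the unrelated notion for measures).
\<close>

definition abs_continuous_on :: "real \<Rightarrow> real \<Rightarrow> (real \<Rightarrow> 'b::real_normed_vector) \<Rightarrow> bool" where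
  "abs_continuous_on p q f \<longleftrightarrow>
     (\<forall>\<epsilon>>0. \<exists>\<delta>>0. \<forall>n (u :: nat \<Rightarrow> real) v.
        (\<forall>k<n. p \<le> u k \<and> u k \<le> v k \<and> v k \<le> q) \<and>
        disjoint_family_on (\<lambda>k. {u k<..<v k}) {..<n} \<and>
        (\<Sum>k<n. v k - u k) < \<delta>
        \<longrightarrow> (\<Sum>k<n. norm (f (v k) - f (u k))) < \<epsilon>)"

definition locally_abs_continuous :: "(real \<Rightarrow> 'b::real_normed_vector) \<Rightarrow> bool" where
  "locally_abs_continuous f \<longleftrightarrow> (\<forall>p q. 0 \<le> p \<and> p \<le> q \<longrightarrow> abs_continuous_on p q f)"

text \<open>Only the values \<open>y t\<close> with \<open>t \<ge> 0\<close> matter.\<close>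

definition sweeping_solution ::
    "real^5 \<Rightarrow> real^5 \<Rightarrow> real^5 \<Rightarrow> (real \<Rightarrow> real) \<Rightarrow> (real \<Rightarrow> real^5) \<Rightarrow> bool" where
  "sweeping_solution a cm cp l y \<longleftrightarrow>
     locally_abs_continuous y \<and>
     (\<forall>t\<ge>0. y t \<in> moving_set a cm cp l t) \<and>
     (AE t in lebesgue. 0 \<le> t \<longrightarrow>
        (\<exists>y'. (y has_vector_derivative y') (at t within {0..}) \<and>
              - y' \<in> normal_cone a (moving_set a cm cp l t) (y t)))"

definition stress :: "real^5 \<Rightarrow> (real \<Rightarrow> real) \<Rightarrow> (real \<Rightarrow> real^5) \<Rightarrow> real \<Rightarrow> real^5" where
  "stress a l y t = stiffness a *v (y t - c_shift a l t)"

definition plastic :: "real^5 \<Rightarrow> real^5 \<Rightarrow> real^5 \<Rightarrow> 5 \<Rightarrow> bool" where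
  "plastic cm cp s j \<longleftrightarrow> s $ j \<in> {cm $ j, cp $ j}"

datatype side = Minus | Plus

primrec elastic_limit :: "real^5 \<Rightarrow> real^5 \<Rightarrow> side \<Rightarrow> 5 \<Rightarrow> real" where
  "elastic_limit cm cp Minus j = cm $ j"
| "elastic_limit cm cp Plus j = cp $ j"

datatype scenario = S1 | S2 | S3 | S4 | S5 | S6 | S7 | S8

primrec I0 :: "scenario \<Rightarrow> (side \<times> 5) set" where
  "I0 S1 = {(Plus, 1), (Plus, 2)}"
| "I0 S2 = {(Plus, 1), (Plus, 2)}"
| "I0 S3 = {(Plus, 1), (Plus, 2)}"
| "I0 S4 = {(Plus, 4), (Plus, 5)}"
| "I0 S5 = {(Plus, 4), (Plus, 5)}"
| "I0 S6 = {(Plus, 4), (Plus, 5)}"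
| "I0 S7 = {(Plus, 1), (Minus, 3), (Plus, 5)}"
| "I0 S8 = {(Plus, 2), (Plus, 3), (Plus, 4)}"

text \<open>
  The terminal stress. In \<open>S1\<close>--\<open>S6\<close> the sides \<open>Minus\<close> and \<open>Plus\<close> give the two
  endpoints of the segment of terminal stresses; in \<open>S7\<close> and \<open>S8\<close> there is a single terminal
  stress and the side is ignored.
\<close>

primrec terminal_stress :: "real^5 \<Rightarrow> real^5 \<Rightarrow> scenario \<Rightarrow> side \<Rightarrow> real^5" where
  "terminal_stress cm cp S1 \<sigma> = (let c3 = elastic_limit cm cp \<sigma> 3 in
     vector [cp$1, cp$2, c3, cp$1 - c3, cp$2 + c3])"
| "terminal_stress cm cp S2 \<sigma> = (let c4 = elastic_limit cm cp \<sigma> 4 in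
     vector [cp$1, cp$2, cp$1 - c4, c4, cp$1 + cp$2 - c4])"
| "terminal_stress cm cp S3 \<sigma> = (let c5 = elastic_limit cm cp \<sigma> 5 in
     vector [cp$1, cp$2, - cp$2 + c5, cp$1 + cp$2 - c5, c5])"
| "terminal_stress cm cp S4 \<sigma> = (let c1 = elastic_limit cm cp \<sigma> 1 in
     vector [c1, - c1 + cp$4 + cp$5, c1 - cp$4, cp$4, cp$5])"
| "terminal_stress cm cp S5 \<sigma> = (let c2 = elastic_limit cm cp \<sigma> 2 in
     vector [- c2 + cp$4 + cp$5, c2, - c2 + cp$5, cp$4, cp$5])"
| "terminal_stress cm cp S6 \<sigma> = (let c3 = elastic_limit cm cp \<sigma> 3 in
     vector [c3 + cp$4, - c3 + cp$5, c3, cp$4, cp$5])"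
| "terminal_stress cm cp S7 \<sigma> =
     vector [cp$1, - cm$3 + cp$5, cm$3, - cm$3 + cp$1, cp$5]"
| "terminal_stress cm cp S8 \<sigma> =
     vector [cp$3 + cp$4, cp$2, cp$3, cp$4, cp$2 + cp$3]"

definition within_limits :: "real^5 \<Rightarrow> real^5 \<Rightarrow> 5 \<Rightarrow> real \<Rightarrow> bool" where
  "within_limits cm cp j r \<longleftrightarrow> cm $ j \<le> r \<and> r \<le> cp $ j"

primrec feasible :: "real^5 \<Rightarrow> real^5 \<Rightarrow> scenario \<Rightarrow> bool" where
  "feasible cm cp S1 = (\<forall>\<sigma>. let c3 = elastic_limit cm cp \<sigma> 3 in
     within_limits cm cp 4 (cp$1 - c3) \<and> within_limits cm cp 5 (cp$2 + c3))"
| "feasible cm cp S2 = (\<forall>\<sigma>. let c4 = elastic_limit cm cp \<sigma> 4 in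
     within_limits cm cp 3 (cp$1 - c4) \<and> within_limits cm cp 5 (cp$1 + cp$2 - c4))"
| "feasible cm cp S3 = (\<forall>\<sigma>. let c5 = elastic_limit cm cp \<sigma> 5 in
     within_limits cm cp 3 (- cp$2 + c5) \<and> within_limits cm cp 4 (cp$1 + cp$2 - c5))"
| "feasible cm cp S4 = (\<forall>\<sigma>. let c1 = elastic_limit cm cp \<sigma> 1 in
     within_limits cm cp 2 (- c1 + cp$4 + cp$5) \<and> within_limits cm cp 3 (c1 - cp$4))"
| "feasible cm cp S5 = (\<forall>\<sigma>. let c2 = elastic_limit cm cp \<sigma> 2 in
     within_limits cm cp 1 (- c2 + cp$4 + cp$5) \<and> within_limits cm cp 3 (- c2 + cp$5))"
| "feasible cm cp S6 = (\<forall>\<sigma>. let c3 = elastic_limit cm cp \<sigma> 3 in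
     within_limits cm cp 1 (c3 + cp$4) \<and> within_limits cm cp 2 (- c3 + cp$5))"
| "feasible cm cp S7 =
     (within_limits cm cp 2 (- cm$3 + cp$5) \<and> within_limits cm cp 4 (- cm$3 + cp$1))"
| "feasible cm cp S8 =
     (within_limits cm cp 1 (cp$3 + cp$4) \<and> within_limits cm cp 5 (cp$2 + cp$3))"

end

theory Submission
  imports Defs
begin

text \<open>
  On the plane of equilibrated stresses the loading direction acts as \<open>s \<mapsto> s$1 + s$2\<close>, so in
  stress coordinates the sweeping process is the gradient flow of the linear function
  \<open>l1 * (s$1 + s$2)\<close> on the polytope of admissible stresses, and the segments of terminal
  stresses are the faces on which it is maximal; the identities
  \<open>s$1 + s$2 = s$4 + s$5 = s$1 - s$3 + s$5 = s$2 + s$3 + s$4\<close> explain the index sets. A linear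
  function grows at a rate bounded below away from its maximal face, so this face is reached in
  finite time, and once there the stress no longer moves. Conversely every point of the face is
  an equilibrium.
\<close>

subsection \<open>Absolutely continuous functions\<close>

text \<open>Absolute continuity speaks of indexed families of disjoint open intervals, a gauge
  argument of divisions. An enumeration of the finite division translates between them, as members
  with disjoint interiors give disjoint open intervals.\<close>

lemma abs_continuous_on_tagged_partial_division:
  fixes f :: "real \<Rightarrow> 'b::real_normed_vector"
  assumes "abs_continuous_on p q f" "\<epsilon> > 0"
  obtains \<delta> where "\<delta> > 0"
    "\<And>\<D>. \<D> tagged_partial_division_of {p..q} \<Longrightarrow> (\<Sum>(x, K)\<in>\<D>. measure lborel K) < \<delta> \<Longrightarrow>
       (\<Sum>(x, K)\<in>\<D>. norm (f (Sup K) - f (Inf K))) < \<epsilon>"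
proof -
  obtain \<delta> where \<delta>: "\<delta> > 0" and
    small: "\<And>n (u :: nat \<Rightarrow> real) v. (\<forall>k<n. p \<le> u k \<and> u k \<le> v k \<and> v k \<le> q) \<Longrightarrow>
        disjoint_family_on (\<lambda>k. {u k<..<v k}) {..<n} \<Longrightarrow> (\<Sum>k<n. v k - u k) < \<delta> \<Longrightarrow>
        (\<Sum>k<n. norm (f (v k) - f (u k))) < \<epsilon>"
  proof -
    from assms have "\<exists>\<delta>>0. \<forall>n (u :: nat \<Rightarrow> real) v.
        (\<forall>k<n. p \<le> u k \<and> u k \<le> v k \<and> v k \<le> q) \<and>
        disjoint_family_on (\<lambda>k. {u k<..<v k}) {..<n} \<and> (\<Sum>k<n. v k - u k) < \<delta> \<longrightarrow>
        (\<Sum>k<n. norm (f (v k) - f (u k))) < \<epsilon>"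
      unfolding abs_continuous_on_def by (elim allE impE)
    then show ?thesis using that by (elim exE conjE) simp
  qed
  show thesis
  proof (rule that[OF \<delta>])
    fix \<D> assume \<D>: "\<D> tagged_partial_division_of {p..q}"
      and sm: "(\<Sum>(x, K)\<in>\<D>. measure lborel K) < \<delta>"
    note D = tagged_partial_division_ofD[OF \<D>]
    obtain h where h: "bij_betw h {..<card \<D>} \<D>"
      using ex_bij_betw_nat_finite[OF D(1)] by (auto simp: atLeast0LessThan)
    define u where "u k = Inf (snd (h k))" for k
    define v where "v k = Sup (snd (h k))" for k
    have cb: "u k \<le> v k \<and> snd (h k) = {u k..v k} \<and> p \<le> u k \<and> v k \<le> q" if "k < card \<D>" for k
    proof -
      obtain x K where xK: "h k = (x, K)" by fastforce
      then have m: "(x, K) \<in> \<D>" using bij_betwE[OF h] that by force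
      obtain c d where cd: "K = {c..d}" using D(4)[OF m] by auto
      show ?thesis using D(2,3)[OF m] xK cd by (auto simp: u_def v_def)
    qed
    have reidx: "(\<Sum>k<card \<D>. g (h k)) = sum g \<D>" for g :: "_ \<Rightarrow> real"
      by (rule sum.reindex_bij_betw[OF h])
    have "(\<Sum>k<card \<D>. norm (f (v k) - f (u k))) < \<epsilon>"
    proof (rule small)
      show "disjoint_family_on (\<lambda>k. {u k<..<v k}) {..<card \<D>}"
        unfolding disjoint_family_on_def
      proof (intro ballI impI)
        fix i j assume ij: "i \<in> {..<card \<D>}" "j \<in> {..<card \<D>}" "i \<noteq> j"
        then have ne: "h i \<noteq> h j" "h i \<in> \<D>" "h j \<in> \<D>"
          using h by (auto simp: bij_betw_def inj_on_def)
        have "interior (snd (h i)) \<inter> interior (snd (h j)) = {}"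
          using D(5)[of "fst (h i)" "snd (h i)" "fst (h j)" "snd (h j)"] ne by auto
        then show "{u i<..<v i} \<inter> {u j<..<v j} = {}"
          using cb[of i] cb[of j] ij by (auto simp: interior_atLeastAtMost_real)
      qed
      have "(\<Sum>k<card \<D>. v k - u k) = (\<Sum>k<card \<D>. measure lborel (snd (h k)))"
        using cb by (intro sum.cong) auto
      also have "\<dots> = (\<Sum>(x, K)\<in>\<D>. measure lborel K)"
        using reidx[of "\<lambda>z. measure lborel (snd z)"] by (simp add: case_prod_beta)
      finally show "(\<Sum>k<card \<D>. v k - u k) < \<delta>" using sm by simp
    qed (use cb in auto)
    also have "(\<Sum>k<card \<D>. norm (f (v k) - f (u k))) = (\<Sum>(x, K)\<in>\<D>. norm (f (Sup K) - f (Inf K)))"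
      using reidx[of "\<lambda>z. norm (f (Sup (snd z)) - f (Inf (snd z)))"]
      by (simp add: case_prod_beta u_def v_def)
    finally show "(\<Sum>(x, K)\<in>\<D>. norm (f (Sup K) - f (Inf K))) < \<epsilon>" .
  qed
qed

text \<open>The intervals do not overlap, so their contents add up to the measure of their union,
  which lies in \<open>U\<close>.\<close>

lemma sum_content_tagged_partial_division_le:
  assumes "\<D> tagged_partial_division_of S" "\<And>x K. (x, K) \<in> \<D> \<Longrightarrow> K \<subseteq> U" "U \<in> lmeasurable"
  shows "(\<Sum>(x, K)\<in>\<D>. measure lborel K) \<le> measure lebesgue U"
proof -
  have div: "snd ` \<D> division_of \<Union>(snd ` \<D>)"
    using assms(1) by (rule partial_division_of_tagged_division)
  \<comment> \<open>\<open>snd\<close> may merge pairs that carry the same interval with different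
    tags. Such an interval has empty interior, hence content zero, so the sum is not
    affected.\<close>
  have "(\<Sum>(x, K)\<in>\<D>. measure lborel K) = sum (measure lborel) (snd ` \<D>)"
    using tagged_partial_division_of_Union_self[OF assms(1)]
    by (rule sum.over_tagged_division_lemma) (simp add: content_eq_0_interior)
  also have "\<dots> = sum (measure lebesgue) (snd ` \<D>)"
    by (intro sum.cong refl) (metis division_ofD(4)[OF div] measure_completion sets_lborel borel_closed closed_cbox)
  also have "\<dots> = measure lebesgue (\<Union>(snd ` \<D>))"
    by (rule content_division[OF div])
  also have "\<dots> \<le> measure lebesgue U"
  proof (rule measure_mono_fmeasurable)
    show "\<Union>(snd ` \<D>) \<in> sets lebesgue"
      using lmeasurable_division[OF div] by (rule fmeasurableD)
    show "\<Union>(snd ` \<D>) \<subseteq> U" using assms(2) by fastforce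
  qed (use assms in auto)
  finally show ?thesis .
qed

text \<open>First-order expansion at \<open>t\<close> towards both ends. Since \<open>t\<close> lies
  between \<open>u\<close> and \<open>v\<close>, the two errors add up to
  \<open>\<epsilon> * (v - u)\<close>, and the linear term \<open>d * (v - u)\<close> is
  nonpositive.\<close>

lemma has_real_derivative_nonpos_straddle:
  fixes f :: "real \<Rightarrow> real"
  assumes "(f has_real_derivative d) (at t within S)" "d \<le> 0" "\<epsilon> > 0"
  shows "\<exists>r>0. \<forall>u\<in>S. \<forall>v\<in>S. u \<le> t \<longrightarrow> t \<le> v \<longrightarrow> dist t u < r \<longrightarrow> dist t v < r \<longrightarrow>
           f v - f u \<le> \<epsilon> * (v - u)"
proof -
  obtain r where r: "r > 0" and
    b: "\<And>x. x \<in> S \<Longrightarrow> \<bar>x - t\<bar> < r \<Longrightarrow> \<bar>f x - f t - d * (x - t)\<bar> \<le> \<epsilon> * \<bar>x - t\<bar>"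
    using assms(1,3) unfolding has_field_derivative_def has_derivative_within_alt real_norm_def by blast
  have "f v - f u \<le> \<epsilon> * (v - u)"
    if "u \<in> S" "v \<in> S" "u \<le> t" "t \<le> v" "dist t u < r" "dist t v < r" for u v
  proof -
    have "\<bar>f u - f t - d * (u - t)\<bar> \<le> \<epsilon> * (t - u)" "\<bar>f v - f t - d * (v - t)\<bar> \<le> \<epsilon> * (v - t)"
      using b[of u] b[of v] that by (auto simp: dist_real_def)
    then have "f v - f u \<le> d * (v - u) + \<epsilon> * (v - u)"
      by (simp add: algebra_simps abs_le_iff)
    moreover have "d * (v - u) \<le> 0" using that assms(2) by (simp add: mult_nonpos_nonneg)
    ultimately show ?thesis by simp
  qed
  then show ?thesis using r by blast
qed

text \<open>A tagged division of \<open>[p, q]\<close> is chosen so that the intervals tagged in the exceptional null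
  set lie in an open set of small measure, where absolute continuity controls the increments;
  on the other intervals the derivative does.\<close>

lemma abs_continuous_on_nonincreasing:
  fixes f :: "real \<Rightarrow> real"
  assumes ac: "abs_continuous_on p q f" and pq: "p \<le> q"
    and N: "N \<in> null_sets lebesgue"
    and der: "\<And>t. t \<in> {p..q} - N \<Longrightarrow> \<exists>d\<le>0. (f has_real_derivative d) (at t within {p..q})"
  shows "f q \<le> f p"
proof -
  have "f q - f p \<le> 0 + \<epsilon>" if \<epsilon>: "\<epsilon> > 0" for \<epsilon>
  proof -
    \<comment> \<open>The well-behaved intervals will contribute at most
      \<open>\<eta> * (q - p)\<close> and the exceptional ones at most \<open>\<eta>\<close>; the
      summand 1 also covers \<open>p = q\<close>.\<close>
    define \<eta> where "\<eta> = \<epsilon> / (q - p + 1)"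
    have "\<eta> * (q - p + 1) = \<epsilon>" using pq by (simp add: \<eta>_def)
    then have \<eta>: "\<eta> > 0" "\<eta> * (q - p) + \<eta> = \<epsilon>"
      using \<epsilon> pq by (simp_all add: \<eta>_def distrib_left)
    obtain \<delta> where \<delta>: "\<delta> > 0" and
      small: "\<And>\<D>. \<D> tagged_partial_division_of {p..q} \<Longrightarrow> (\<Sum>(x, K)\<in>\<D>. measure lborel K) < \<delta> \<Longrightarrow>
        (\<Sum>(x, K)\<in>\<D>. norm (f (Sup K) - f (Inf K))) < \<eta>"
      using abs_continuous_on_tagged_partial_division[OF ac \<eta>(1)] by blast
    obtain U where U: "open U" "N \<subseteq> U" "U - N \<in> lmeasurable" "emeasure lebesgue (U - N) < ennreal \<delta>"
      using sets_lebesgue_outer_open[OF null_setsD2[OF N] \<delta>] .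
    have Us: "U \<in> sets lebesgue" using U(1) by simp
    \<comment> \<open>Outer regularity bounds only \<open>U - N\<close>; removing the null set
      \<open>N\<close> leaves the measure of \<open>U\<close> unchanged.\<close>
    have Ue: "emeasure lebesgue U < ennreal \<delta>"
      using U(4) emeasure_Diff_null_set[OF N Us] by simp
    then have Um: "U \<in> lmeasurable"
      using Us by (intro fmeasurableI) (auto intro: less_trans[OF _ ennreal_less_top])
    then have Ud: "measure lebesgue U < \<delta>"
      using Ue \<delta> by (simp add: emeasure_eq_measure2 ennreal_less_iff)
    have "\<exists>r>0. (t \<in> N \<longrightarrow> ball t r \<subseteq> U) \<and>
        (t \<in> {p..q} - N \<longrightarrow> (\<forall>u\<in>{p..q}. \<forall>v\<in>{p..q}. u \<le> t \<longrightarrow> t \<le> v \<longrightarrow> dist t u < r \<longrightarrow>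
            dist t v < r \<longrightarrow> f v - f u \<le> \<eta> * (v - u)))" for t
    proof (cases "t \<in> N")
      case True
      then show ?thesis using U(1,2) by (meson DiffD2 openE subsetD)
    next
      case F: False
      show ?thesis
      proof (cases "t \<in> {p..q}")
        case True
        with F der obtain d where "d \<le> 0" "(f has_real_derivative d) (at t within {p..q})" by blast
        from has_real_derivative_nonpos_straddle[OF this(2,1) \<eta>(1)] F show ?thesis by blast
      next
        case False
        \<comment> \<open>A gauge must be defined on the whole line; outside \<open>{p..q}\<close>
          and \<open>N\<close> any radius will do.\<close>
        with F show ?thesis by (intro exI[of _ 1]) auto
      qed
    qed
    then obtain r where r: "\<And>t. r t > 0" "\<And>t. t \<in> N \<Longrightarrow> ball t (r t) \<subseteq> U"
      "\<And>t u v. t \<in> {p..q} - N \<Longrightarrow> u \<in> {p..q} \<Longrightarrow> v \<in> {p..q} \<Longrightarrow> u \<le> t \<Longrightarrow> t \<le> v \<Longrightarrow>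
         dist t u < r t \<Longrightarrow> dist t v < r t \<Longrightarrow> f v - f u \<le> \<eta> * (v - u)"
      by metis
    have "gauge (\<lambda>t. ball t (r t))" using r(1) by (simp add: gauge_ball_dependent)
    then obtain \<D> where \<D>: "\<D> tagged_division_of {p..q}" and fine: "(\<lambda>t. ball t (r t)) fine \<D>"
      by (rule fine_division_exists_real)
    note D = tagged_division_ofD[OF \<D>]
    have sub: "K \<subseteq> ball x (r x)" if "(x, K) \<in> \<D>" for x K
      using fine that by (auto simp: fine_def)
    define B where "B = {z \<in> \<D>. fst z \<in> N}"
    have B: "B \<subseteq> \<D>" by (auto simp: B_def)
    have Bp: "B tagged_partial_division_of {p..q}"
      using \<D> B by (meson tagged_division_of_def tagged_partial_division_subset)
    have "(\<Sum>(x, K)\<in>B. measure lborel K) \<le> measure lebesgue U"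
    proof (rule sum_content_tagged_partial_division_le[OF Bp _ Um])
      fix x K assume "(x, K) \<in> B"
      then show "K \<subseteq> U" using sub[of x K] r(2)[of x] by (auto simp: B_def)
    qed
    then have "(\<Sum>(x, K)\<in>B. measure lborel K) < \<delta>" using Ud by simp
    then have bad: "(\<Sum>(x, K)\<in>B. norm (f (Sup K) - f (Inf K))) < \<eta>" by (rule small[OF Bp])
    have "(\<Sum>(x, K)\<in>B. f (Sup K) - f (Inf K)) \<le> (\<Sum>(x, K)\<in>B. norm (f (Sup K) - f (Inf K)))"
      by (intro sum_mono) (auto simp: case_prod_beta)
    with bad have bad': "(\<Sum>(x, K)\<in>B. f (Sup K) - f (Inf K)) < \<eta>" by simp
    have good: "(\<Sum>(x, K)\<in>\<D> - B. f (Sup K) - f (Inf K)) \<le> (\<Sum>(x, K)\<in>\<D> - B. \<eta> * measure lborel K)"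
    proof (rule sum_mono, clarify)
      fix x K assume xK: "(x, K) \<in> \<D>" "(x, K) \<notin> B"
      obtain u v where uv: "K = {u..v}" using D(4)[OF xK(1)] by auto
      have "x \<in> K" "K \<subseteq> {p..q}" using D(2,3)[OF xK(1)] by auto
      moreover have "u \<in> ball x (r x)" "v \<in> ball x (r x)"
        using \<open>x \<in> K\<close> subsetD[OF sub[OF xK(1)]] unfolding uv by simp_all
      ultimately show "f (Sup K) - f (Inf K) \<le> \<eta> * measure lborel K"
        using xK uv r(3)[of x u v] by (auto simp: B_def)
    qed
    have "(\<Sum>(x, K)\<in>\<D> - B. \<eta> * measure lborel K) \<le> (\<Sum>(x, K)\<in>\<D>. \<eta> * measure lborel K)"
      using D(1) \<eta>(1) by (intro sum_mono2) (auto simp: case_prod_beta)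
    also have "\<dots> = \<eta> * (\<Sum>(x, K)\<in>\<D>. measure lborel K)"
      by (simp add: sum_distrib_left case_prod_beta)
    also have "(\<Sum>(x, K)\<in>\<D>. measure lborel K) = q - p"
      using additive_content_tagged_division[of \<D> p q] \<D> pq by simp
    finally have good': "(\<Sum>(x, K)\<in>\<D> - B. \<eta> * measure lborel K) \<le> \<eta> * (q - p)" .
    have "f q - f p = (\<Sum>(x, K)\<in>\<D>. f (Sup K) - f (Inf K))"
      using additive_tagged_division_1[OF pq \<D>, of f] by simp
    also have "\<dots> = (\<Sum>(x, K)\<in>\<D> - B. f (Sup K) - f (Inf K)) + (\<Sum>(x, K)\<in>B. f (Sup K) - f (Inf K))"
      using sum.subset_diff[OF B D(1)] .
    finally show ?thesis using good good' bad' \<eta>(2) by linarith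
  qed
  then have "f q - f p \<le> 0" by (rule field_le_epsilon)
  then show ?thesis by simp
qed

section \<open>Closure properties of absolute continuity\<close>

lemma abs_continuous_on_lipschitz:
  fixes f :: "real \<Rightarrow> 'b::real_normed_vector"
  assumes lip: "\<And>u v. u \<le> v \<Longrightarrow> norm (f v - f u) \<le> L * (v - u)"
  shows "abs_continuous_on p q f"
  unfolding abs_continuous_on_def
proof (intro allI impI)
  fix \<epsilon> :: real assume \<epsilon>: "\<epsilon> > 0"
  \<comment> \<open>\<open>L\<close> comes without a sign; \<open>\<bar>L\<bar> + 1\<close> is a
    positive Lipschitz constant.\<close>
  have pos: "\<epsilon> / (\<bar>L\<bar> + 1) > 0" using \<epsilon> by (intro divide_pos_pos) auto
  moreover have "(\<Sum>k<n. norm (f (v k) - f (u k))) < \<epsilon>"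
    if k: "\<forall>k<n. p \<le> u k \<and> u k \<le> v k \<and> v k \<le> q" and s: "(\<Sum>k<n. v k - u k) < \<epsilon> / (\<bar>L\<bar> + 1)"
    for n and u v :: "nat \<Rightarrow> real"
  proof -
    have "(\<Sum>k<n. norm (f (v k) - f (u k))) \<le> (\<Sum>k<n. (\<bar>L\<bar> + 1) * (v k - u k))"
    proof (rule sum_mono)
      fix i assume "i \<in> {..<n}"
      then have "u i \<le> v i" using k by simp
      then show "norm (f (v i) - f (u i)) \<le> (\<bar>L\<bar> + 1) * (v i - u i)"
        by (intro order.trans[OF lip] mult_right_mono) auto
    qed
    also have "\<dots> = (\<bar>L\<bar> + 1) * (\<Sum>k<n. v k - u k)" by (simp add: sum_distrib_left)
    also have "\<dots> < \<epsilon>" using s by (simp add: pos_less_divide_eq mult.commute)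
    finally show ?thesis .
  qed
  ultimately show "\<exists>\<delta>>0. \<forall>n (u :: nat \<Rightarrow> real) v.
      (\<forall>k<n. p \<le> u k \<and> u k \<le> v k \<and> v k \<le> q) \<and>
      disjoint_family_on (\<lambda>k. {u k<..<v k}) {..<n} \<and> (\<Sum>k<n. v k - u k) < \<delta> \<longrightarrow>
      (\<Sum>k<n. norm (f (v k) - f (u k))) < \<epsilon>"
    by (intro exI[of _ "\<epsilon> / (\<bar>L\<bar> + 1)"]) simp
qed

lemma abs_continuous_on_affine: "abs_continuous_on p q (\<lambda>t. b + t *\<^sub>R d)"
proof (rule abs_continuous_on_lipschitz)
  fix u v :: real assume "u \<le> v"
  then show "norm ((b + v *\<^sub>R d) - (b + u *\<^sub>R d)) \<le> norm d * (v - u)"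
    by (simp add: scaleR_left_diff_distrib[symmetric])
qed

lemma abs_continuous_on_add:
  fixes f g :: "real \<Rightarrow> 'b::real_normed_vector"
  assumes "abs_continuous_on p q f" "abs_continuous_on p q g"
  shows "abs_continuous_on p q (\<lambda>t. f t + g t)"
  unfolding abs_continuous_on_def
proof (intro allI impI)
  fix \<epsilon> :: real assume \<epsilon>: "\<epsilon> > 0"
  let ?P = "\<lambda>f \<epsilon> \<delta>. \<forall>n (u :: nat \<Rightarrow> real) v.
      (\<forall>k<n. p \<le> u k \<and> u k \<le> v k \<and> v k \<le> q) \<and>
      disjoint_family_on (\<lambda>k. {u k<..<v k}) {..<n} \<and> (\<Sum>k<n. v k - u k) < \<delta> \<longrightarrow>
      (\<Sum>k<n. norm (f (v k) - f (u k))) < \<epsilon>"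
  have ex: "\<exists>\<delta>>0. ?P h (\<epsilon> / 2) \<delta>" if "abs_continuous_on p q h" for h :: "real \<Rightarrow> 'b"
    using that half_gt_zero[OF \<epsilon>] unfolding abs_continuous_on_def by (elim allE impE)
  obtain \<delta>1 \<delta>2 where \<delta>: "\<delta>1 > 0" "\<delta>2 > 0" and P: "?P f (\<epsilon> / 2) \<delta>1" "?P g (\<epsilon> / 2) \<delta>2"
    using ex[OF assms(1)] ex[OF assms(2)] by (elim exE conjE)
  have "?P (\<lambda>t. f t + g t) \<epsilon> (min \<delta>1 \<delta>2)"
  proof (intro allI impI, elim conjE)
    fix n and u v :: "nat \<Rightarrow> real"
    assume A: "\<forall>k<n. p \<le> u k \<and> u k \<le> v k \<and> v k \<le> q"
      "disjoint_family_on (\<lambda>k. {u k<..<v k}) {..<n}" "(\<Sum>k<n. v k - u k) < min \<delta>1 \<delta>2"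
    have "(\<Sum>k<n. norm (f (v k) + g (v k) - (f (u k) + g (u k))))
        \<le> (\<Sum>k<n. norm (f (v k) - f (u k)) + norm (g (v k) - g (u k)))"
      by (intro sum_mono) (simp add: norm_diff_triangle_ineq)
    also have "\<dots> = (\<Sum>k<n. norm (f (v k) - f (u k))) + (\<Sum>k<n. norm (g (v k) - g (u k)))"
      by (rule sum.distrib)
    also have "\<dots> < \<epsilon> / 2 + \<epsilon> / 2"
      using A P[rule_format, of n u v] by (intro add_strict_mono) auto
    finally show "(\<Sum>k<n. norm (f (v k) + g (v k) - (f (u k) + g (u k)))) < \<epsilon>" by simp
  qed
  then show "\<exists>\<delta>>0. ?P (\<lambda>t. f t + g t) \<epsilon> \<delta>"
    using \<delta> by (intro exI[of _ "min \<delta>1 \<delta>2"] conjI) simp_all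
qed

lemma abs_continuous_on_bounded_linear:
  fixes f :: "real \<Rightarrow> 'b::real_normed_vector" and h :: "'b \<Rightarrow> 'c::real_normed_vector"
  assumes h: "bounded_linear h" and ac: "abs_continuous_on p q f"
  shows "abs_continuous_on p q (\<lambda>t. h (f t))"
  unfolding abs_continuous_on_def
proof (intro allI impI)
  fix \<epsilon> :: real assume \<epsilon>: "\<epsilon> > 0"
  let ?P = "\<lambda>g \<epsilon> \<delta>. \<forall>n (u :: nat \<Rightarrow> real) v.
      (\<forall>k<n. p \<le> u k \<and> u k \<le> v k \<and> v k \<le> q) \<and>
      disjoint_family_on (\<lambda>k. {u k<..<v k}) {..<n} \<and> (\<Sum>k<n. v k - u k) < \<delta> \<longrightarrow>
      (\<Sum>k<n. norm (g (v k) - g (u k))) < \<epsilon>"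
  obtain K where K: "K > 0" "\<And>x. norm (h x) \<le> norm x * K"
    using bounded_linear.pos_bounded[OF h] by blast
  have "\<exists>\<delta>>0. ?P f (\<epsilon> / K) \<delta>"
    using ac divide_pos_pos[OF \<epsilon> K(1)] unfolding abs_continuous_on_def by (elim allE impE)
  then obtain \<delta> where \<delta>: "\<delta> > 0" and P: "?P f (\<epsilon> / K) \<delta>" by (elim exE conjE)
  have "?P (\<lambda>t. h (f t)) \<epsilon> \<delta>"
  proof (intro allI impI)
    fix n and u v :: "nat \<Rightarrow> real"
    assume A: "(\<forall>k<n. p \<le> u k \<and> u k \<le> v k \<and> v k \<le> q) \<and>
      disjoint_family_on (\<lambda>k. {u k<..<v k}) {..<n} \<and> (\<Sum>k<n. v k - u k) < \<delta>"
    have "(\<Sum>k<n. norm (h (f (v k)) - h (f (u k)))) \<le> (\<Sum>k<n. norm (f (v k) - f (u k)) * K)"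
      by (intro sum_mono) (simp add: K(2) linear_diff[OF bounded_linear.linear[OF h], symmetric])
    also have "\<dots> = (\<Sum>k<n. norm (f (v k) - f (u k))) * K" by (simp add: sum_distrib_right)
    also have "\<dots> < \<epsilon>" using P[rule_format, OF A] K(1) by (simp add: pos_less_divide_eq)
    finally show "(\<Sum>k<n. norm (h (f (v k)) - h (f (u k)))) < \<epsilon>" .
  qed
  with \<delta> show "\<exists>\<delta>>0. ?P (\<lambda>t. h (f t)) \<epsilon> \<delta>" by (intro exI conjI)
qed

section \<open>Consequences of derivative bounds that hold almost everywhere\<close>

lemma abs_continuous_on_const_if_derivative_zero:
  fixes f :: "real \<Rightarrow> real"
  assumes ac: "abs_continuous_on p q f" and pq: "p \<le> q" and N: "N \<in> null_sets lebesgue"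
    and der: "\<And>t. t \<in> {p..q} - N \<Longrightarrow> (f has_real_derivative 0) (at t within {p..q})"
  shows "f q = f p"
proof (rule antisym)
  show "f q \<le> f p"
    using ac pq N by (rule abs_continuous_on_nonincreasing) (use der in blast)
  have "- f q \<le> - f p"
  proof (rule abs_continuous_on_nonincreasing[OF _ pq N])
    show "abs_continuous_on p q (\<lambda>t. - f t)"
      by (rule abs_continuous_on_bounded_linear[OF _ ac]) (rule bounded_linear_minus[OF bounded_linear_ident])
    show "\<exists>d\<le>0. ((\<lambda>t. - f t) has_real_derivative d) (at t within {p..q})" if "t \<in> {p..q} - N" for t
      using DERIV_minus[OF der[OF that]] by (intro exI[of _ 0]) simp
  qed
  then show "f p \<le> f q" by simp
qed

text \<open>If \<open>\<phi> t\<close> were positive, monotonicity would make \<open>\<phi>\<close>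
  positive on all of \<open>{0..t}\<close>, so the rate bound would hold almost everywhere there.
  Then \<open>\<phi> s + s * \<kappa>\<close> is nonincreasing, which gives
  \<open>\<phi> t \<le> \<phi> 0 - t * \<kappa> \<le> 0\<close>.\<close>

lemma finite_time_extinction:
  fixes \<phi> :: "real \<Rightarrow> real"
  assumes ac: "locally_abs_continuous \<phi>"
    and nonneg: "\<And>t. t \<ge> 0 \<Longrightarrow> \<phi> t \<ge> 0"
    and \<kappa>: "\<kappa> > 0" and N: "N \<in> null_sets lebesgue"
    and der: "\<And>t. t \<ge> 0 \<Longrightarrow> t \<notin> N \<Longrightarrow>
       \<exists>d\<le>0. (\<phi> has_real_derivative d) (at t within {0..}) \<and> (\<phi> t > 0 \<longrightarrow> d \<le> - \<kappa>)"
    and t: "t \<ge> \<phi> 0 / \<kappa>"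
  shows "\<phi> t = 0"
proof (rule ccontr)
  assume ne: "\<phi> t \<noteq> 0"
  have t0: "t \<ge> 0" using t nonneg[of 0] \<kappa> by (meson divide_nonneg_pos order.trans order_refl)
  have acI: "abs_continuous_on p q \<phi>" if "0 \<le> p" "p \<le> q" for p q
    using ac that by (simp add: locally_abs_continuous_def)
  have mono: "\<phi> q \<le> \<phi> p" if pq: "0 \<le> p" "p \<le> q" for p q
  proof (rule abs_continuous_on_nonincreasing[OF acI[OF pq] pq(2) N])
    fix s assume "s \<in> {p..q} - N"
    then obtain d where "d \<le> 0" "(\<phi> has_real_derivative d) (at s within {0..})"
      using der[of s] pq by auto
    moreover have "{p..q} \<subseteq> {0..}" using pq by auto
    ultimately show "\<exists>d\<le>0. (\<phi> has_real_derivative d) (at s within {p..q})"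
      using DERIV_subset by blast
  qed
  have pos: "\<phi> s > 0" if "s \<in> {0..t}" for s
    using ne nonneg[OF t0] mono[of s t] that by force
  have "\<phi> t + t *\<^sub>R \<kappa> \<le> \<phi> 0 + 0 *\<^sub>R \<kappa>"
  proof (rule abs_continuous_on_nonincreasing[where f = "\<lambda>s. \<phi> s + s *\<^sub>R \<kappa>", OF _ t0 N])
    show "abs_continuous_on 0 t (\<lambda>s. \<phi> s + s *\<^sub>R \<kappa>)"
      using abs_continuous_on_add[OF acI[OF order_refl t0] abs_continuous_on_affine[of 0 t 0 \<kappa>]] by simp
    fix s assume s: "s \<in> {0..t} - N"
    then obtain d where d: "(\<phi> has_real_derivative d) (at s within {0..})" "d \<le> - \<kappa>"
      using der[of s] pos[of s] by auto
    have "((\<lambda>s. \<phi> s + s *\<^sub>R \<kappa>) has_real_derivative d + \<kappa>) (at s within {0..t})"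
      by (rule DERIV_subset[of _ _ _ "{0..}"]) (auto intro!: derivative_eq_intros d(1))
    with d(2) show "\<exists>d\<le>0. ((\<lambda>s. \<phi> s + s *\<^sub>R \<kappa>) has_real_derivative d) (at s within {0..t})"
      by (intro exI[of _ "d + \<kappa>"]) simp
  qed
  then have "\<phi> t + t * \<kappa> \<le> \<phi> 0" by simp
  moreover have "\<phi> 0 \<le> t * \<kappa>" using t \<kappa> by (simp add: pos_divide_le_eq)
  ultimately show False using ne nonneg[OF t0] by simp
qed

subsection \<open>The sweeping process in stress coordinates\<close>

lemma stiffness_mult_component [simp]: "(stiffness a *v x) $ i = a $ i * x $ i"
proof -
  have "(stiffness a *v x) $ i = (\<Sum>j\<in>UNIV. if j = i then a $ i * x $ i else 0)"
    unfolding matrix_vector_mult_def stiffness_def vec_lambda_beta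
    by (intro sum.cong) auto
  then show ?thesis by simp
qed

text \<open>The equations are the balance of forces at the second and third node. In these
  coordinates the moving constraint becomes a fixed polytope that depends neither on time nor on the
  stiffness.\<close>

definition admissible_stresses :: "real^5 \<Rightarrow> real^5 \<Rightarrow> (real^5) set" where
  "admissible_stresses cm cp =
     {s. s$1 = s$3 + s$4 \<and> s$5 = s$2 + s$3 \<and> (\<forall>i. cm $ i \<le> s $ i \<and> s $ i \<le> cp $ i)}"

lemma convex_admissible_stresses: "convex (admissible_stresses cm cp)"
proof -
  have "convex {s :: real^5. s$1 - s$3 - s$4 = 0 \<and> s$5 - s$2 - s$3 = 0}"
    by (auto simp: convex_def algebra_simps)
  moreover have "convex (cbox cm cp)" by simp
  ultimately have "convex ({s :: real^5. s$1 - s$3 - s$4 = 0 \<and> s$5 - s$2 - s$3 = 0} \<inter> cbox cm cp)"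
    by (rule convex_Int)
  also have "\<dots> = admissible_stresses cm cp"
    by (auto simp: admissible_stresses_def mem_box_cart)
  finally show ?thesis .
qed

lemma V_space_iff_equilibrium:
  assumes "\<forall>i. a $ i > 0"
  defines "s \<equiv> \<lambda>y. stiffness a *v y"
  shows "y \<in> V_space a \<longleftrightarrow> s y $ 1 = s y $ 3 + s y $ 4 \<and> s y $ 5 = s y $ 2 + s y $ 3"
proof
  assume "y \<in> V_space a"
  then have L: "R_vec \<bullet> (D_mat *v \<xi>) = 0 \<Longrightarrow> s y \<bullet> (D_mat *v \<xi>) = 0" for \<xi>
    using V_space_iff[OF assms(1)] by (simp add: s_def)
  \<comment> \<open>Displacing only the second or only the third node leaves
    \<open>R_vec \<bullet> (D_mat *v \<xi>)\<close>, the distance change between the first and the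
    last node, equal to zero.\<close>
  from L[of "vector [0,1,0,0]"] L[of "vector [0,0,1,0]"]
  show "s y $ 1 = s y $ 3 + s y $ 4 \<and> s y $ 5 = s y $ 2 + s y $ 3"
    by (simp add: D_mat_def R_vec_def inner_vec_def matrix_vector_mult_def[of "vector _"] sum_4 sum_5)
next
  assume E: "s y $ 1 = s y $ 3 + s y $ 4 \<and> s y $ 5 = s y $ 2 + s y $ 3"
  have "s y \<bullet> (D_mat *v \<xi>) = 0" if "R_vec \<bullet> (D_mat *v \<xi>) = 0" for \<xi>
  proof -
    \<comment> \<open>In equilibrium the stress does work only against the loading; the factor is
      the transmitted force \<open>s$1 + s$2\<close>.\<close>
    have "s y \<bullet> (D_mat *v \<xi>) = (s y $ 3 + s y $ 4 + s y $ 2) * (R_vec \<bullet> (D_mat *v \<xi>))"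
      using E by (simp add: D_mat_def R_vec_def inner_vec_def matrix_vector_mult_def[of "vector _"]
          sum_4 sum_5 algebra_simps)
    with that show ?thesis by simp
  qed
  then show "y \<in> V_space a" unfolding V_space_iff[OF assms(1)] s_def by blast
qed

lemma subspace_V_space: "subspace (V_space a)"
  unfolding V_space_def by (rule linear_subspace_image[OF matrix_vector_mul_linear subspace_UNIV])

definition loading_direction :: "real^5 \<Rightarrow> real^5" where
  "loading_direction a = V_basis a *v (matrix_inv (P_mat ** V_basis a) *v vector [1, 0, 0])"

lemma c_shift_eq: "c_shift a l t = - (l t *\<^sub>R loading_direction a)"
  by (simp add: c_shift_def loading_direction_def)

lemma loading_direction_in_V_space: "loading_direction a \<in> V_space a"
  by (simp add: loading_direction_def V_space_def)

text \<open>The inverse matrix is never computed: \<open>P_mat\<close> maps the loading direction to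
  \<open>(1, 0, 0)\<close>, which expresses three of its components by the first and third. Those
  two cancel against the equilibrium equations.\<close>

lemma loading_direction_inner:
  assumes a: "\<forall>i. a $ i > 0" and s: "s$1 = s$3 + s$4" "s$5 = s$2 + s$3"
  shows "loading_direction a \<bullet> s = s$1 + s$2"
proof -
  let ?M = "P_mat ** V_basis a" and ?w = "loading_direction a"
  have "P_mat *v ?w = (?M ** matrix_inv ?M) *v vector [1, 0, 0]"
    by (simp add: loading_direction_def matrix_vector_mul_assoc matrix_mul_assoc)
  also have "\<dots> = vector [1, 0, 0]"
    using someI_ex[OF invertible_P_mat_V_basis[OF a, unfolded invertible_def]]
    by (simp add: matrix_inv_def)
  finally have "?w$1 + ?w$3 + ?w$5 = 1" "?w$3 - ?w$4 + ?w$5 = 0" "?w$1 - ?w$2 + ?w$3 = 0"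
    by (auto simp: P_mat_def vec_eq_iff forall_3 matrix_vector_mult_def sum_5)
  then have w: "?w$5 = 1 - ?w$1 - ?w$3" "?w$4 = 1 - ?w$1" "?w$2 = ?w$1 + ?w$3" by auto
  show ?thesis
    unfolding inner_vec_def sum_5 inner_real_def w s by (simp add: algebra_simps)
qed

lemma moving_set_iff:
  assumes "\<forall>i. a $ i > 0"
  shows "\<eta> \<in> moving_set a cm cp l t \<longleftrightarrow>
    stiffness a *v (\<eta> - c_shift a l t) \<in> admissible_stresses cm cp"
proof -
  have "\<eta> \<in> moving_set a cm cp l t \<longleftrightarrow> \<eta> - c_shift a l t \<in> C_set a cm cp"
    by (force simp: moving_set_def)
  also have "\<dots> \<longleftrightarrow> stiffness a *v (\<eta> - c_shift a l t) \<in> admissible_stresses cm cp"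
    by (auto simp: C_set_def V_space_iff_equilibrium[OF assms] admissible_stresses_def inner_axis')
  finally show ?thesis .
qed

lemma exists_displacement:
  assumes "\<forall>i. a $ i > 0"
  obtains x where "stiffness a *v x = s"
proof (rule that)
  show "stiffness a *v (\<chi> i. s $ i / a $ i) = s"
    using less_imp_neq[OF assms[rule_format]] by (simp add: vec_eq_iff)
qed

text \<open>The stiffness weight of the scalar product is absorbed into the stresses, and every
  admissible stress comes from some point of the moving set. This leaves a Euclidean pairing of
  rates with stress differences.\<close>

lemma normal_cone_moving_set_iff:
  assumes "\<forall>i. a $ i > 0"
  shows "x \<in> normal_cone a (moving_set a cm cp l t) \<eta> \<longleftrightarrow>
    x \<in> V_space a \<and> stiffness a *v (\<eta> - c_shift a l t) \<in> admissible_stresses cm cp \<and>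
    (\<forall>s\<in>admissible_stresses cm cp. x \<bullet> (s - stiffness a *v (\<eta> - c_shift a l t)) \<le> 0)"
proof -
  let ?c = "c_shift a l t" and ?S = "admissible_stresses cm cp"
  have "(\<forall>\<xi>\<in>moving_set a cm cp l t. x \<bullet> (stiffness a *v (\<xi> - \<eta>)) \<le> 0) \<longleftrightarrow>
      (\<forall>s\<in>?S. x \<bullet> (s - stiffness a *v (\<eta> - ?c)) \<le> 0)" (is "?L \<longleftrightarrow> ?R")
  proof
    assume L: ?L
    show ?R
    proof
      fix s assume s: "s \<in> ?S"
      obtain z where z: "stiffness a *v z = s" using exists_displacement[OF assms] .
      have "z + ?c \<in> moving_set a cm cp l t"
        using s z by (simp add: moving_set_iff[OF assms])
      moreover have "s - stiffness a *v (\<eta> - ?c) = stiffness a *v (z + ?c - \<eta>)"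
        unfolding z[symmetric] by (simp add: vec_eq_iff algebra_simps)
      ultimately show "x \<bullet> (s - stiffness a *v (\<eta> - ?c)) \<le> 0" using L by simp
    qed
  next
    assume R: ?R
    show ?L
    proof
      fix \<xi> assume "\<xi> \<in> moving_set a cm cp l t"
      then have "stiffness a *v (\<xi> - ?c) \<in> ?S" by (simp add: moving_set_iff[OF assms])
      moreover have "stiffness a *v (\<xi> - ?c) - stiffness a *v (\<eta> - ?c) = stiffness a *v (\<xi> - \<eta>)"
        by (simp add: vec_eq_iff algebra_simps)
      ultimately show "x \<bullet> (stiffness a *v (\<xi> - \<eta>)) \<le> 0" using R by metis
    qed
  qed
  then show ?thesis by (auto simp: normal_cone_def moving_set_iff[OF assms])
qed

lemma stress_admissible:
  assumes "\<forall>i. a $ i > 0" "sweeping_solution a cm cp l y" "t \<ge> 0"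
  shows "stress a l y t \<in> admissible_stresses cm cp"
  using assms(2,3) by (simp add: sweeping_solution_def moving_set_iff[OF assms(1)] stress_def)

lemma stress_eq:
  "stress a l y t = stiffness a *v (y t + l t *\<^sub>R loading_direction a)"
  by (simp add: stress_def c_shift_eq)

text \<open>Under affine loading the stress is a linear image of \<open>y\<close> plus an affine
  path. The offset \<open>b\<close> admits both the stress components and their deficit from the
  maximal load.\<close>

lemma locally_abs_continuous_stress:
  assumes y: "locally_abs_continuous y" and h: "bounded_linear h"
  shows "locally_abs_continuous (\<lambda>t. b + h (stress a (\<lambda>t. l0 + l1 * t) y t))"
  unfolding locally_abs_continuous_def
proof (intro allI impI, elim conjE)
  fix p q :: real assume "0 \<le> p" "p \<le> q"
  then have "abs_continuous_on p q y" using y by (simp add: locally_abs_continuous_def)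
  then have "abs_continuous_on p q
      (\<lambda>t. y t + (l0 *\<^sub>R loading_direction a + t *\<^sub>R (l1 *\<^sub>R loading_direction a)))"
    by (rule abs_continuous_on_add) (rule abs_continuous_on_affine)
  from abs_continuous_on_bounded_linear[OF bounded_linear_compose[OF h] this,
      OF matrix_vector_mul_bounded_linear[of "stiffness a"]]
  have "abs_continuous_on p q (\<lambda>t. h (stress a (\<lambda>t. l0 + l1 * t) y t))"
    by (simp add: stress_eq algebra_simps)
  from abs_continuous_on_add[OF abs_continuous_on_affine[of p q b 0] this]
  show "abs_continuous_on p q (\<lambda>t. b + h (stress a (\<lambda>t. l0 + l1 * t) y t))" by simp
qed

text \<open>The maximum principle for the stress path: at a time \<open>t > 0\<close> of differentiability, both
  directions of time are available in the normal cone inequality, so the normal vector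
  \<open>l1 *\<^sub>R loading_direction a - u\<close> is orthogonal to the stress rate. This turns the energy
  \<open>u \<bullet> (stiffness a *v u)\<close> of the elastic rate into the growth rate of \<open>s$1 + s$2\<close>.\<close>

lemma stress_rate:
  assumes a: "\<forall>i. a $ i > 0" and l: "l = (\<lambda>t. l0 + l1 * t)" and t: "t > 0"
    and adm: "\<And>\<tau>. \<tau> \<ge> 0 \<Longrightarrow> stress a l y \<tau> \<in> admissible_stresses cm cp"
    and der: "(y has_vector_derivative y') (at t within {0..})"
    and nc: "- y' \<in> normal_cone a (moving_set a cm cp l t) (y t)"
  obtains u where
    "(stress a l y has_vector_derivative stiffness a *v u) (at t within {0..})"
    "u \<bullet> (stiffness a *v u) = l1 * ((stiffness a *v u) $ 1 + (stiffness a *v u) $ 2)"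
    "\<And>z. z \<in> admissible_stresses cm cp \<Longrightarrow>
       l1 * (z$1 + z$2 - (stress a l y t $ 1 + stress a l y t $ 2)) \<le> u \<bullet> (z - stress a l y t)"
proof -
  let ?w = "loading_direction a" and ?s = "stress a l y" and ?S = "admissible_stresses cm cp"
  \<comment> \<open>\<open>u\<close> is the elastic rate, the derivative of \<open>y\<close> minus
    the shift; the normal vector \<open>n\<close> is the part of the loading rate that the elastic
    response does not take up.\<close>
  define u where "u = y' + l1 *\<^sub>R ?w"
  define n where "n = l1 *\<^sub>R ?w - u"
  have n: "n = - y'" by (simp add: n_def u_def)
  have nV: "y' \<in> V_space a" and ncone: "\<And>z. z \<in> ?S \<Longrightarrow> n \<bullet> (z - ?s t) \<le> 0"
    using nc subspace_neg[OF subspace_V_space, of "- y'" a]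
    by (auto simp: normal_cone_moving_set_iff[OF a] stress_def n)
  have u: "u \<in> V_space a" unfolding u_def
    by (intro subspace_add[OF subspace_V_space] subspace_scale[OF subspace_V_space] nV
        loading_direction_in_V_space)
  have "((\<lambda>\<tau>. y \<tau> + l \<tau> *\<^sub>R ?w) has_vector_derivative u) (at t within {0..})"
    unfolding u_def l
    by (intro has_vector_derivative_add der) (auto intro!: derivative_eq_intros simp: has_vector_derivative_def)
  from bounded_linear.has_vector_derivative[OF matrix_vector_mul_bounded_linear[of "stiffness a"] this]
  have sder: "(?s has_vector_derivative stiffness a *v u) (at t within {0..})"
    by (simp add: stress_eq[abs_def])
  from bounded_linear.has_vector_derivative[OF bounded_linear_inner_right[of n] this]
  have "((\<lambda>\<tau>. n \<bullet> ?s \<tau>) has_vector_derivative n \<bullet> (stiffness a *v u)) (at t within {0..})" .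
  moreover have at: "at t within {0..} = at t"
    using t by (intro at_within_interior) simp
  ultimately have "((\<lambda>\<tau>. n \<bullet> ?s \<tau>) has_real_derivative n \<bullet> (stiffness a *v u)) (at t)"
    using at by (simp add: has_real_derivative_iff_has_vector_derivative)
  then have "n \<bullet> (stiffness a *v u) = 0"
  \<comment> \<open>Radius \<open>t\<close> keeps the comparison times nonnegative, where the stress
    is known to be admissible.\<close>
  proof (rule DERIV_local_max[OF _ t], intro allI impI)
    fix \<tau> assume "\<bar>t - \<tau>\<bar> < t"
    then have "\<tau> \<ge> 0" by linarith
    from ncone[OF adm[OF this]] show "n \<bullet> ?s \<tau> \<le> n \<bullet> ?s t" by (simp add: inner_diff_right)
  qed
  then have "u \<bullet> (stiffness a *v u) = l1 * (?w \<bullet> (stiffness a *v u))"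
    by (simp add: n_def inner_diff_left)
  moreover have "?w \<bullet> (stiffness a *v u) = (stiffness a *v u) $ 1 + (stiffness a *v u) $ 2"
    using u V_space_iff_equilibrium[OF a] by (intro loading_direction_inner[OF a]) simp_all
  ultimately have 2: "u \<bullet> (stiffness a *v u) = l1 * ((stiffness a *v u) $ 1 + (stiffness a *v u) $ 2)"
    by simp
  have w: "?w \<bullet> z = z$1 + z$2" if "z \<in> ?S" for z
    using that by (intro loading_direction_inner[OF a]) (auto simp: admissible_stresses_def)
  have 3: "l1 * (z$1 + z$2 - (?s t $ 1 + ?s t $ 2)) \<le> u \<bullet> (z - ?s t)" if z: "z \<in> ?S" for z
  proof -
    have "l1 * (?w \<bullet> z - ?w \<bullet> ?s t) \<le> u \<bullet> (z - ?s t)"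
      using ncone[OF z] by (simp add: n_def inner_diff_left inner_diff_right right_diff_distrib)
    then show ?thesis using t by (simp add: w[OF z] w[OF adm])
  qed
  show thesis by (rule that[OF sder 2 3])
qed

subsection \<open>Finite-time convergence\<close>

lemma elastic_energy_eq: "u \<bullet> (stiffness a *v u) = (\<Sum>i\<in>UNIV. a $ i * (u $ i)\<^sup>2)"
  by (simp add: inner_vec_def power2_eq_square mult_ac)

text \<open>The hypotheses bound the sum of the \<open>\<bar>u $ i\<bar>\<close> below by
  \<open>c\<close>, so one of the five components is at least \<open>c / 5\<close> in size, and its
  term alone carries the bound. Below, \<open>d\<close> leads from the stress to a nearby maximizer
  and \<open>c\<close> is \<open>l1\<close>.\<close>

lemma elastic_energy_lower_bound:
  fixes u d :: "real^5"
  assumes a: "\<forall>i. a $ i > 0" and \<phi>: "\<phi> > 0" "\<And>i. \<bar>d $ i\<bar> \<le> \<phi>"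
    and c: "c > 0" "c * \<phi> \<le> u \<bullet> d"
  shows "Min (range (($) a)) * (c / 5)\<^sup>2 \<le> u \<bullet> (stiffness a *v u)"
proof -
  have "u \<bullet> d \<le> (\<Sum>i\<in>UNIV. \<bar>u $ i\<bar> * \<phi>)"
    unfolding inner_vec_def
  proof (rule sum_mono)
    fix i
    have "u $ i \<bullet> d $ i \<le> \<bar>u $ i\<bar> * \<bar>d $ i\<bar>" by (simp add: abs_mult[symmetric])
    also have "\<dots> \<le> \<bar>u $ i\<bar> * \<phi>" using \<phi>(2) by (rule mult_left_mono) simp
    finally show "u $ i \<bullet> d $ i \<le> \<bar>u $ i\<bar> * \<phi>" .
  qed
  then have "c * \<phi> \<le> (\<Sum>i\<in>UNIV. \<bar>u $ i\<bar>) * \<phi>" using c(2) by (simp add: sum_distrib_right)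
  then have "c \<le> (\<Sum>i\<in>UNIV. \<bar>u $ i\<bar>)" using \<phi>(1) by simp
  moreover have "(\<Sum>i\<in>UNIV. \<bar>u $ i\<bar>) < c" if "\<forall>i. \<bar>u $ i\<bar> < c / 5"
    using that unfolding sum_5 forall_5 by linarith
  ultimately obtain i where i: "c / 5 \<le> \<bar>u $ i\<bar>" by (meson not_le)
  have "Min (range (($) a)) * (c / 5)\<^sup>2 \<le> a $ i * (u $ i)\<^sup>2"
  proof (rule mult_mono)
    show "(c / 5)\<^sup>2 \<le> (u $ i)\<^sup>2" using i c(1) by (simp add: abs_le_square_iff[symmetric])
  qed (use a in \<open>auto simp: less_imp_le\<close>)
  also have "\<dots> \<le> (\<Sum>i\<in>UNIV. a $ i * (u $ i)\<^sup>2)"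
    by (rule member_le_sum) (use a in \<open>auto simp: less_imp_le\<close>)
  finally show ?thesis by (simp add: elastic_energy_eq)
qed

lemma elastic_energy_eq_0_iff:
  assumes "\<forall>i. a $ i > 0"
  shows "u \<bullet> (stiffness a *v u) = 0 \<longleftrightarrow> u = 0"
  unfolding elastic_energy_eq using assms
  by (subst sum_nonneg_eq_0_iff) (auto simp: less_imp_le vec_eq_iff less_imp_neq[symmetric])

text \<open>The hypothesis \<open>near\<close> is a sharpness condition: the distance of an admissible stress to
  the set \<open>Z\<close> of maximizers of \<open>s$1 + s$2\<close> is controlled by its deficit. It keeps the
  dissipation away from zero until \<open>Z\<close> is reached, which therefore happens in finite time.\<close>

lemma stress_eventually_constant:
  assumes a: "\<forall>i. a $ i > 0" and l: "l = (\<lambda>t. l0 + l1 * t)" and l1: "l1 > 0"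
    and sol: "sweeping_solution a cm cp l y"
    and near: "\<And>s. s \<in> admissible_stresses cm cp \<Longrightarrow> \<exists>z\<in>Z. \<forall>i. \<bar>z $ i - s $ i\<bar> \<le> M - (s$1 + s$2)"
    and Z: "\<And>z. z \<in> Z \<Longrightarrow> z \<in> admissible_stresses cm cp \<and> z$1 + z$2 = M"
  shows "\<exists>t0\<ge>0. \<exists>s\<in>Z. \<forall>t\<ge>t0. stress a l y t = s"
proof -
  let ?s = "stress a l y"
  define \<phi> where "\<phi> t = M - (?s t $ 1 + ?s t $ 2)" for t
  \<comment> \<open>The energy is at least \<open>Min (range (($) a)) * (l1 / 5)\<^sup>2\<close>
    while the deficit \<open>\<phi>\<close> is positive, and it equals \<open>- l1\<close> times the
    derivative of \<open>\<phi>\<close>; hence the division by \<open>l1\<close>.\<close>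
  define \<kappa> where "\<kappa> = Min (range (($) a)) * (l1 / 5)\<^sup>2 / l1"
  have min: "Min (range (($) a)) > 0" using a by (subst Min_gr_iff) auto
  have \<kappa>: "\<kappa> > 0" using min l1 by (simp add: \<kappa>_def)
  have y: "locally_abs_continuous y" using sol by (simp add: sweeping_solution_def)
  have adm: "?s t \<in> admissible_stresses cm cp" if "t \<ge> 0" for t
    using stress_admissible[OF a sol that] .
  have \<phi>0: "\<phi> t \<ge> 0" if "t \<ge> 0" for t
    using near[OF adm[OF that]] by (force simp: \<phi>_def)
  have "bounded_linear (\<lambda>s :: real^5. - (s$1 + s$2))"
    by (intro bounded_linear_minus bounded_linear_add bounded_linear_vec_nth)
  from locally_abs_continuous_stress[where a = a and ?b = M and ?l0.0 = l0 and ?l1.0 = l1, OF y this]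
  have \<phi>ac: "locally_abs_continuous \<phi>" by (simp add: \<phi>_def[abs_def] l algebra_simps)
  define P where "P t \<longleftrightarrow> (\<exists>y'. (y has_vector_derivative y') (at t within {0..}) \<and>
      - y' \<in> normal_cone a (moving_set a cm cp l t) (y t))" for t
  have "AE t in lebesgue. 0 \<le> t \<longrightarrow> P t" using sol by (simp add: sweeping_solution_def P_def)
  then obtain N0 where N0: "N0 \<in> null_sets lebesgue" "{t. \<not> (0 \<le> t \<longrightarrow> P t)} \<subseteq> N0"
    by (auto simp: eventually_ae_filter)
  \<comment> \<open>Time 0 is discarded because \<open>stress_rate\<close> needs both directions of
    time.\<close>
  define N where "N = insert 0 N0"
  have N: "N \<in> null_sets lebesgue"
    using N0(1) by (simp add: N_def negligible_iff_null_sets[symmetric])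
  have rate: "\<exists>u d. (?s has_vector_derivative stiffness a *v u) (at t within {0..}) \<and>
      (\<phi> has_real_derivative d) (at t within {0..}) \<and> u \<bullet> (stiffness a *v u) = - (l1 * d) \<and>
      (\<phi> t > 0 \<longrightarrow> d \<le> - \<kappa>)" if t: "t \<ge> 0" "t \<notin> N" for t
  proof -
    have "t > 0" "t \<notin> N0" using t by (auto simp: N_def)
    then have "P t" using N0(2) less_imp_le by blast
    then obtain y' where y': "(y has_vector_derivative y') (at t within {0..})"
      "- y' \<in> normal_cone a (moving_set a cm cp l t) (y t)" unfolding P_def by blast
    obtain u where u: "(?s has_vector_derivative stiffness a *v u) (at t within {0..})"
      "u \<bullet> (stiffness a *v u) = l1 * ((stiffness a *v u) $ 1 + (stiffness a *v u) $ 2)"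
      "\<And>z. z \<in> admissible_stresses cm cp \<Longrightarrow>
         l1 * (z$1 + z$2 - (?s t $ 1 + ?s t $ 2)) \<le> u \<bullet> (z - ?s t)"
      using stress_rate[OF a l \<open>t > 0\<close> adm y'] by blast
    define d where "d = - ((stiffness a *v u) $ 1 + (stiffness a *v u) $ 2)"
    have comp: "((\<lambda>t. ?s t $ i) has_real_derivative (stiffness a *v u) $ i) (at t within {0..})" for i
      using bounded_linear.has_vector_derivative[OF bounded_linear_vec_nth u(1)]
      by (simp add: has_real_derivative_iff_has_vector_derivative)
    have d1: "(\<phi> has_real_derivative d) (at t within {0..})"
      unfolding \<phi>_def[abs_def] d_def by (rule derivative_eq_intros comp refl | simp)+
    have d2: "u \<bullet> (stiffness a *v u) = - (l1 * d)" by (simp add: u(2) d_def algebra_simps)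
    have d3: "d \<le> - \<kappa>" if "\<phi> t > 0"
    proof -
      obtain z where z: "z \<in> Z" "\<And>i. \<bar>z $ i - ?s t $ i\<bar> \<le> \<phi> t"
        using near[OF adm[OF t(1)]] by (auto simp: \<phi>_def)
      have "l1 * \<phi> t \<le> u \<bullet> (z - ?s t)" using u(3)[of z] Z[OF z(1)] by (simp add: \<phi>_def)
      then have "Min (range (($) a)) * (l1 / 5)\<^sup>2 \<le> u \<bullet> (stiffness a *v u)"
        by (intro elastic_energy_lower_bound[OF a that _ l1]) (simp_all add: z(2))
      then show ?thesis using l1 by (simp add: d2 \<kappa>_def field_simps)
    qed
    show ?thesis using u(1) d1 d2 d3 by blast
  qed
  have ext: "\<phi> t = 0" if "t \<ge> \<phi> 0 / \<kappa>" for t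
  proof (rule finite_time_extinction[OF \<phi>ac \<phi>0 \<kappa> N _ that])
    fix t assume "0 \<le> t" "t \<notin> N"
    from rate[OF this] obtain u d where d: "(\<phi> has_real_derivative d) (at t within {0..})"
      "u \<bullet> (stiffness a *v u) = - (l1 * d)" "\<phi> t > 0 \<longrightarrow> d \<le> - \<kappa>" by blast
    have "u \<bullet> (stiffness a *v u) \<ge> 0"
      unfolding elastic_energy_eq using a by (intro sum_nonneg) (simp add: less_imp_le)
    then have "d \<le> 0" using d(2) l1 by (simp add: mult_le_0_iff)
    with d show "\<exists>d\<le>0. (\<phi> has_real_derivative d) (at t within {0..}) \<and> (\<phi> t > 0 \<longrightarrow> d \<le> - \<kappa>)"
      by blast
  qed
  define t0 where "t0 = \<phi> 0 / \<kappa>"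
  have t0: "t0 \<ge> 0" using \<phi>0[of 0] \<kappa> by (simp add: t0_def)
  have const: "?s t = ?s t0" if "t \<ge> t0" for t
  proof (intro vec_eq_iff[THEN iffD2] allI)
    fix i
    have "abs_continuous_on t0 t (\<lambda>t. ?s t $ i)"
      using locally_abs_continuous_stress[where a = a and ?b = 0 and ?l0.0 = l0 and ?l1.0 = l1, OF y bounded_linear_vec_nth[of i]] t0 that
      by (simp add: locally_abs_continuous_def l)
    \<comment> \<open>Discarding \<open>t0\<close> leaves times with a neighbourhood on which
      \<open>\<phi>\<close> vanishes. There its derivative is zero, hence so is the elastic energy,
      hence so is the stress rate.\<close>
    moreover have "insert t0 N \<in> null_sets lebesgue"
      using N by (simp add: negligible_iff_null_sets[symmetric])
    ultimately show "?s t $ i = ?s t0 $ i"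
    proof (rule abs_continuous_on_const_if_derivative_zero[OF _ that])
      fix r assume r: "r \<in> {t0..t} - insert t0 N"
      then have "r \<ge> 0" "r \<notin> N" "r > t0" using t0 by auto
      from rate[OF this(1,2)] obtain u d where
        u: "(?s has_vector_derivative stiffness a *v u) (at r within {0..})" and
        d: "(\<phi> has_real_derivative d) (at r within {0..})" "u \<bullet> (stiffness a *v u) = - (l1 * d)"
        by blast
      have at: "at r within {0..} = at r"
        using \<open>r > t0\<close> t0 by (intro at_within_interior) simp
      have "((\<lambda>_. 0) has_real_derivative d) (at r)"
      proof (rule has_field_derivative_transform_within_open[OF d(1)[unfolded at]])
        show "open {t0<..}" "r \<in> {t0<..}" using \<open>r > t0\<close> by auto
        show "\<phi> x = 0" if "x \<in> {t0<..}" for x using that ext[of x] by (simp add: t0_def)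
      qed
      then have "d = 0" using DERIV_const DERIV_unique by blast
      then have "u = 0" using d(2) elastic_energy_eq_0_iff[OF a, of u] by simp
      with u have "(?s has_vector_derivative 0) (at r within {0..})" by simp
      from bounded_linear.has_vector_derivative[OF bounded_linear_vec_nth this]
      have "((\<lambda>t. ?s t $ i) has_real_derivative 0) (at r within {0..})"
        by (simp add: has_real_derivative_iff_has_vector_derivative)
      then show "((\<lambda>t. ?s t $ i) has_real_derivative 0) (at r within {t0..t})"
        by (rule DERIV_subset) (use t0 in auto)
    qed
  qed
  obtain z where z: "z \<in> Z" "\<forall>i. \<bar>z $ i - ?s t0 $ i\<bar> \<le> \<phi> t0"
    using near[OF adm[OF t0]] by (auto simp: \<phi>_def)
  \<comment> \<open>With zero deficit, the sharpness bound makes the nearby maximizer coincide with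
    the stress itself.\<close>
  have "z = ?s t0" using z(2) ext[of t0] by (simp add: t0_def vec_eq_iff)
  with z(1) const t0 show ?thesis by blast
qed

text \<open>The state is carried along rigidly by the moving set. Its negative velocity
  \<open>l1 *\<^sub>R ?w\<close> pairs with stresses as \<open>l1 * (s$1 + s$2)\<close>, so the
  normal cone condition is exactly the maximality of \<open>z\<close>.\<close>

lemma exists_solution_with_constant_stress:
  assumes a: "\<forall>i. a $ i > 0" and l: "l = (\<lambda>t. l0 + l1 * t)" and l1: "l1 > 0"
    and z: "z \<in> admissible_stresses cm cp"
    and max: "\<And>s. s \<in> admissible_stresses cm cp \<Longrightarrow> s$1 + s$2 \<le> z$1 + z$2"
  shows "\<exists>y. sweeping_solution a cm cp l y \<and> (\<forall>t. stress a l y t = z)"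
proof -
  let ?w = "loading_direction a"
  obtain x where x: "stiffness a *v x = z" using exists_displacement[OF a] .
  define y where "y t = x - l t *\<^sub>R ?w" for t
  have s: "stress a l y t = z" for t by (simp add: stress_eq y_def x)
  have y: "y = (\<lambda>t. (x - l0 *\<^sub>R ?w) + t *\<^sub>R (- (l1 *\<^sub>R ?w)))"
    by (simp add: y_def l fun_eq_iff algebra_simps)
  have w: "?w \<bullet> s = s$1 + s$2" if "s \<in> admissible_stresses cm cp" for s
    using that by (intro loading_direction_inner[OF a]) (auto simp: admissible_stresses_def)
  have "l1 *\<^sub>R ?w \<in> normal_cone a (moving_set a cm cp l t) (y t)" for t
  proof -
    have "(l1 *\<^sub>R ?w) \<bullet> (s - z) \<le> 0" if "s \<in> admissible_stresses cm cp" for s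
      using max[OF that] l1 by (simp add: inner_diff_right w that z mult_le_0_iff)
    then show ?thesis
      using z s[of t] subspace_scale[OF subspace_V_space loading_direction_in_V_space]
      by (simp add: normal_cone_moving_set_iff[OF a] stress_def)
  qed
  moreover have "(y has_vector_derivative - (l1 *\<^sub>R ?w)) (at t within {0..})" for t
    unfolding y by (auto intro!: derivative_eq_intros simp: has_vector_derivative_def)
  moreover have "locally_abs_continuous y"
    unfolding locally_abs_continuous_def y by (intro allI impI abs_continuous_on_affine)
  moreover have "y t \<in> moving_set a cm cp l t" for t
    using s[of t] z by (simp add: moving_set_iff[OF a] stress_def)
  ultimately have "sweeping_solution a cm cp l y"
    unfolding sweeping_solution_def by (intro conjI AE_I2 allI impI exI[of _ "- (l1 *\<^sub>R ?w)"]) simp_all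
  with s show ?thesis by blast
qed

subsection \<open>The terminal segments\<close>

text \<open>Equilibrium is built into the displayed vectors; the components set to a limit are
  covered by \<open>lim\<close>, the others by feasibility.\<close>

lemma terminal_stress_admissible:
  assumes lim: "\<forall>i. cm $ i \<le> cp $ i" and f: "feasible cm cp k"
  shows "terminal_stress cm cp k \<sigma> \<in> admissible_stresses cm cp"
proof -
  have "within_limits cm cp j (elastic_limit cm cp \<sigma> j)" for j
    using lim by (cases \<sigma>) (simp_all add: within_limits_def)
  with f lim show ?thesis
    by (cases k) (auto simp: admissible_stresses_def forall_5 within_limits_def Let_def)
qed

lemma closed_segment_component_eq:
  fixes x y z :: "real^'n"
  assumes "z \<in> closed_segment x y" "x $ i = r" "y $ i = r"
  shows "z $ i = r"
proof -
  obtain u where "z = (1 - u) *\<^sub>R x + u *\<^sub>R y" using assms(1) by (auto simp: in_segment)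
  then have "z $ i = (1 - u) * r + u * r" using assms(2,3) by simp
  then show ?thesis by (simp add: algebra_simps)
qed

lemma terminal_stress_I0:
  assumes "z \<in> closed_segment (terminal_stress cm cp k Minus) (terminal_stress cm cp k Plus)"
    and "(\<sigma>, j) \<in> I0 k"
  shows "z $ j = elastic_limit cm cp \<sigma> j"
proof (rule closed_segment_component_eq[OF assms(1)])
  show "terminal_stress cm cp k Minus $ j = elastic_limit cm cp \<sigma> j"
    "terminal_stress cm cp k Plus $ j = elastic_limit cm cp \<sigma> j"
    using assms(2) by (cases k; auto simp: Let_def)+
qed

text \<open>In each scenario the deficit is the sum of the nonnegative gaps between \<open>s\<close>
  and the limits listed in \<open>I0\<close>. If \<open>z\<close> is matched to \<open>s\<close> in
  the free component, every difference \<open>z $ i - s $ i\<close> is, up to sign, zero or a sum of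
  some of these gaps.\<close>

lemma terminal_stress_deficit:
  fixes k :: scenario
  assumes s: "s \<in> admissible_stresses cm cp"
  defines "T \<equiv> terminal_stress cm cp k"
  shows "\<exists>z\<in>closed_segment (T Minus) (T Plus).
    \<forall>i. \<bar>z $ i - s $ i\<bar> \<le> (T Plus $ 1 + T Plus $ 2) - (s$1 + s$2)"
proof -
  have eq: "s$1 = s$3 + s$4" "s$5 = s$2 + s$3" and lim: "cm $ i \<le> s $ i" "s $ i \<le> cp $ i" for i
    using s by (auto simp: admissible_stresses_def)
  note L = lim[of 1] lim[of 2] lim[of 3] lim[of 4] lim[of 5]
  have par: "\<exists>\<mu>. 0 \<le> \<mu> \<and> \<mu> \<le> 1 \<and> s $ i = (1 - \<mu>) * cm $ i + \<mu> * cp $ i" for i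
  proof -
    have "s $ i \<in> closed_segment (cm $ i) (cp $ i)"
      using lim[of i] by (auto simp: closed_segment_eq_real_ivl)
    then show ?thesis by (auto simp: in_segment)
  qed
  \<comment> \<open>The component that parametrizes the segment. In \<open>S7\<close> and
    \<open>S8\<close> the segment is a point and the value 1 is a dummy.\<close>
  define p :: 5 where "p = (case k of S1 \<Rightarrow> 3 | S2 \<Rightarrow> 4 | S3 \<Rightarrow> 5 | S4 \<Rightarrow> 1 | S5 \<Rightarrow> 2 | S6 \<Rightarrow> 3 | _ \<Rightarrow> 1)"
  obtain \<mu> where \<mu>: "0 \<le> \<mu>" "\<mu> \<le> 1" "s $ p = (1 - \<mu>) * cm $ p + \<mu> * cp $ p" using par by blast
  define z where "z = (1 - \<mu>) *\<^sub>R T Minus + \<mu> *\<^sub>R T Plus"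
  have zi: "z $ i = (1 - \<mu>) * T Minus $ i + \<mu> * T Plus $ i" for i by (simp add: z_def)
  have "z \<in> closed_segment (T Minus) (T Plus)" using \<mu> by (auto simp: in_segment z_def)
  moreover have "\<bar>z $ i - s $ i\<bar> \<le> (T Plus $ 1 + T Plus $ 2) - (s$1 + s$2)" for i
  proof -
    have "\<forall>i. \<bar>z $ i - s $ i\<bar> \<le> (T Plus $ 1 + T Plus $ 2) - (s$1 + s$2)"
      unfolding forall_5 zi using \<mu>(3) eq L
      by (cases k) (auto simp: T_def p_def Let_def algebra_simps abs_le_iff)
    then show ?thesis by blast
  qed
  ultimately show ?thesis by blast
qed

text \<open>Admissibility passes from the endpoints to the segment by convexity. The second claim
  holds because the parameter cancels in \<open>s$1 + s$2\<close>, so both endpoints give the same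
  value.\<close>

lemma terminal_segment:
  fixes k :: scenario
  assumes lim: "\<forall>i. cm $ i \<le> cp $ i" and f: "feasible cm cp k"
  defines "T \<equiv> terminal_stress cm cp k"
  assumes z: "z \<in> closed_segment (T Minus) (T Plus)"
  shows "z \<in> admissible_stresses cm cp" and "z$1 + z$2 = T Plus $ 1 + T Plus $ 2"
proof -
  have "closed_segment (T Minus) (T Plus) \<subseteq> admissible_stresses cm cp"
    unfolding T_def
    by (intro closed_segment_subset convex_admissible_stresses terminal_stress_admissible[OF lim f])
  with z show "z \<in> admissible_stresses cm cp" by blast
  obtain u where "z = (1 - u) *\<^sub>R T Minus + u *\<^sub>R T Plus" using z by (auto simp: in_segment)
  then have "z $ i = (1 - u) * T Minus $ i + u * T Plus $ i" for i by simp
  then have "z$1 + z$2 = (1 - u) * (T Minus $ 1 + T Minus $ 2) + u * (T Plus $ 1 + T Plus $ 2)"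
    by (simp only: distrib_left ac_simps)
  also have "T Minus $ 1 + T Minus $ 2 = T Plus $ 1 + T Plus $ 2"
    by (cases k) (simp_all add: T_def Let_def)
  finally show "z$1 + z$2 = T Plus $ 1 + T Plus $ 2" by (simp add: algebra_simps)
qed

theorem proposition7:
  fixes a cm cp :: "real^5" and l0 l1 :: real and l :: "real \<Rightarrow> real"
  assumes a_pos: "\<forall>i. a $ i > 0"
    and limits: "\<forall>i. cm $ i \<le> cp $ i"
    and load: "l0 > 0" "l1 > 0" "l = (\<lambda>t. l0 + l1 * t)"
  shows
    "(\<forall>k\<in>{S1, S2, S3, S4, S5, S6}. feasible cm cp k \<longrightarrow>
        (\<forall>y. sweeping_solution a cm cp l y \<longrightarrow>
           (\<exists>t0\<ge>0. \<exists>s\<in>closed_segment (terminal_stress cm cp k Minus) (terminal_stress cm cp k Plus).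
              \<forall>t\<ge>t0. stress a l y t = s \<and>
                (\<forall>(\<sigma>, j)\<in>I0 k. plastic cm cp (stress a l y t) j \<and>
                               stress a l y t $ j = elastic_limit cm cp \<sigma> j))) \<and>
        (\<forall>s\<in>closed_segment (terminal_stress cm cp k Minus) (terminal_stress cm cp k Plus).
           \<exists>y. sweeping_solution a cm cp l y \<and> (\<exists>t0\<ge>0. \<forall>t\<ge>t0. stress a l y t = s))) \<and>
     (\<forall>k\<in>{S7, S8}. feasible cm cp k \<longrightarrow>
        (\<forall>y. sweeping_solution a cm cp l y \<longrightarrow>
           (\<exists>t0\<ge>0. \<forall>t\<ge>t0.
              stress a l y t = terminal_stress cm cp k Plus \<and>
              (\<forall>(\<sigma>, j)\<in>I0 k. plastic cm cp (stress a l y t) j \<and>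
                             stress a l y t $ j = elastic_limit cm cp \<sigma> j))))"
proof -
  let ?Z = "\<lambda>k. closed_segment (terminal_stress cm cp k Minus) (terminal_stress cm cp k Plus)"
  have conv: "\<exists>t0\<ge>0. \<exists>s\<in>?Z k. \<forall>t\<ge>t0. stress a l y t = s \<and>
      (\<forall>(\<sigma>, j)\<in>I0 k. plastic cm cp (stress a l y t) j \<and> stress a l y t $ j = elastic_limit cm cp \<sigma> j)"
    if f: "feasible cm cp k" and sol: "sweeping_solution a cm cp l y" for k y
  proof -
    have "\<exists>t0\<ge>0. \<exists>s\<in>?Z k. \<forall>t\<ge>t0. stress a l y t = s"
      using stress_eventually_constant[OF a_pos load(3,2) sol terminal_stress_deficit[of _ cm cp k]]
        terminal_segment[OF limits f] by blast
    then obtain t0 s where s: "t0 \<ge> 0" "s \<in> ?Z k" "\<And>t. t \<ge> t0 \<Longrightarrow> stress a l y t = s" by blast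
    have "plastic cm cp s j \<and> s $ j = elastic_limit cm cp \<sigma> j" if "(\<sigma>, j) \<in> I0 k" for \<sigma> j
      using terminal_stress_I0[OF s(2) that] by (cases \<sigma>) (simp_all add: plastic_def)
    with s show ?thesis by (intro exI[of _ t0] conjI bexI[of _ s]) auto
  qed
  have attained: "\<exists>y. sweeping_solution a cm cp l y \<and> (\<exists>t0\<ge>0. \<forall>t\<ge>t0. stress a l y t = s)"
    if f: "feasible cm cp k" and s: "s \<in> ?Z k" for k s
  proof -
    \<comment> \<open>The deficit of \<open>r\<close> bounds an absolute value, so it is
      nonnegative: points of the segment are maximizers.\<close>
    have "r$1 + r$2 \<le> s$1 + s$2" if "r \<in> admissible_stresses cm cp" for r
      using terminal_stress_deficit[OF that, of k] terminal_segment(2)[OF limits f s] by force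
    from exists_solution_with_constant_stress[OF a_pos load(3,2) terminal_segment(1)[OF limits f s] this]
    show ?thesis by blast
  qed
  \<comment> \<open>For \<open>S7\<close> and \<open>S8\<close> the segment degenerates to a point,
    so the same convergence result identifies the limit stress completely.\<close>
  have single: "?Z k = {terminal_stress cm cp k Plus}" if "k \<in> {S7, S8}" for k
    using that by auto
  show ?thesis
  proof (intro conjI ballI impI allI)
    fix k y assume "k \<in> {S7, S8}" "feasible cm cp k" "sweeping_solution a cm cp l y"
    then show "\<exists>t0\<ge>0. \<forall>t\<ge>t0. stress a l y t = terminal_stress cm cp k Plus \<and>
        (\<forall>(\<sigma>, j)\<in>I0 k. plastic cm cp (stress a l y t) j \<and> stress a l y t $ j = elastic_limit cm cp \<sigma> j)"
      using conv[of k y] unfolding single[OF \<open>k \<in> {S7, S8}\<close>] bex_simps by blast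
  qed (use conv attained in blast)+
qed

end
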